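(* Let $X$ be a Banach space whose dual $X^*$ is (norm) separable. Then every isometric automorphism $\alpha$ of $X$ has zero CA entropy: $\mathrm{hc}(\alpha)=0$.
   Context: All Banach spaces are over $\mathbb{C}$. CA entropy: For a bounded linear map $\gamma:X\to Y$ of Banach spaces, a finite set $\Omega\subseteq X$ and $\delta>0$, let $\mathrm{CA}(\gamma,\Omega,\delta)$ be the collection of triples $(\phi,\psi,d)$ where $d$ is a positive integer and $\phi:X\to\ell_\infty^d$, $\psi:\ell_\infty^d\to Y$ are contractive (norm $\le1$) linear maps with $\|\psi\circ\phi(x)-\gamma(x)\|<\delta$ for all $x\in\Omega$. A CA embedding of $X$ is an isometric linear map $\iota$ from $X$ into a Banach space $Y$ such that $\mathrm{CA}(\iota,\Omega,\delta)\neq\emptyset$ for all finite $\Omega\subseteq X$ and $\delta>0$; every Banach space has one (e.g. the evaluation map $X\to C(B_1(X^* ))$, where $B_1(X^* )$ is the weak$^*$ compact unit ball of the dual). Set $\mathrm{rc}(\Omega,\delta)=\inf\{d:(\phi,\psi,d)\in\mathrm{CA}(\iota,\Omega,\delta)\}$, which does not depend on the CA embedding $\iota$. For an isometric (surjective linear) automorphism $\alpha$ of $X$ put $\mathrm{hc}(\alpha,\Omega,\delta)=\limsup_{n\to\infty}\frac1n\log\mathrm{rc}(\Omega\cup\alpha\Omega\cup\cdots\cup\alpha^{n-1}\Omega,\delta)$, $\mathrm{hc}(\alpha,\Omega)=\sup_{\delta>0}\mathrm{hc}(\alpha,\Omega,\delta)$, and $\mathrm{hc}(\alpha)=\sup_\Omega\mathrm{hc}(\alpha,\Omega)$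 over finite $\Omega\subseteq X$. *)

theory Defs
  imports "HOL-Analysis.Analysis"
begin

section \<open>Complex Banach spaces\<close>

class complex_normed_vector = real_normed_vector +
  fixes scaleC :: "complex \<Rightarrow> 'a \<Rightarrow> 'a"  (infixr \<open>*\<^sub>C\<close> 75)
  assumes scaleC_add_right: "a *\<^sub>C (x + y) = a *\<^sub>C x + a *\<^sub>C y"
    and scaleC_add_left: "(a + b) *\<^sub>C x = a *\<^sub>C x + b *\<^sub>C x"
    and scaleC_scaleC: "a *\<^sub>C (b *\<^sub>C x) = (a * b) *\<^sub>C x"
    and scaleC_of_real: "complex_of_real r *\<^sub>C x = r *\<^sub>R x"
    and norm_scaleC: "norm (a *\<^sub>C x) = cmod a * norm x"

class complex_banach = complex_normed_vector + banach

instantiation complex :: complex_banach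
begin

definition scaleC_complex :: "complex \<Rightarrow> complex \<Rightarrow> complex"
  where "scaleC_complex a x = a * x"

instance
  by standard (auto simp: scaleC_complex_def algebra_simps norm_mult scaleR_conv_of_real)

end

definition clinear :: "('a::complex_normed_vector \<Rightarrow> 'b::complex_normed_vector) \<Rightarrow> bool"
  where "clinear f \<longleftrightarrow>
    (\<forall>x y. f (x + y) = f x + f y) \<and> (\<forall>c x. f (c *\<^sub>C x) = c *\<^sub>C f x)"

definition isometric_automorphism :: "('a::complex_normed_vector \<Rightarrow> 'a) \<Rightarrow> bool"
  where "isometric_automorphism \<alpha> \<longleftrightarrow> clinear \<alpha> \<and> (\<forall>x. norm (\<alpha> x) = norm x) \<and> surj \<alpha>"

text \<open>
  The type \<open>'a \<Rightarrow>\<^sub>L complex\<close> consists of the bounded \<^emph>\<open>real\<close>-linear maps; the dual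
  \<open>X\<^sup>*\<close> is its subspace of complex-linear maps, with the same operator norm.
\<close>

definition complex_dual :: "('a::complex_normed_vector \<Rightarrow>\<^sub>L complex) set"
  where "complex_dual = {f. clinear (blinfun_apply f)}"


section \<open>CA entropy\<close>

text \<open>
  \<open>\<ell>\<^sub>\<infinity>\<^sup>d\<close> is realised as the sequences vanishing from index \<open>d\<close> on, so that \<open>d\<close> can be
  quantified over. The maximum is used for \<open>d > 0\<close> only.
\<close>

definition linf :: "nat \<Rightarrow> (nat \<Rightarrow> complex) set"
  where "linf d = {v. \<forall>i\<ge>d. v i = 0}"

definition linf_norm :: "nat \<Rightarrow> (nat \<Rightarrow> complex) \<Rightarrow> real"
  where "linf_norm d v = Max ((\<lambda>i. cmod (v i)) ` {..<d})"

definition contractive_to_linf :: "nat \<Rightarrow> ('a::complex_normed_vector \<Rightarrow> nat \<Rightarrow> complex) \<Rightarrow> bool"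
  where "contractive_to_linf d \<phi> \<longleftrightarrow>
    (\<forall>x. \<phi> x \<in> linf d) \<and>
    (\<forall>x y. \<phi> (x + y) = (\<lambda>i. \<phi> x i + \<phi> y i)) \<and>
    (\<forall>c x. \<phi> (c *\<^sub>C x) = (\<lambda>i. c * \<phi> x i)) \<and>
    (\<forall>x. linf_norm d (\<phi> x) \<le> norm x)"

definition contractive_from_linf :: "nat \<Rightarrow> ((nat \<Rightarrow> complex) \<Rightarrow> 'b::complex_normed_vector) \<Rightarrow> bool"
  where "contractive_from_linf d \<psi> \<longleftrightarrow>
    (\<forall>u\<in>linf d. \<forall>v\<in>linf d. \<psi> (\<lambda>i. u i + v i) = \<psi> u + \<psi> v) \<and>
    (\<forall>c. \<forall>v\<in>linf d. \<psi> (\<lambda>i. c * v i) = c *\<^sub>C \<psi> v) \<and>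
    (\<forall>v\<in>linf d. norm (\<psi> v) \<le> linf_norm d v)"

definition CA :: "('a::complex_normed_vector \<Rightarrow> 'b::complex_normed_vector) \<Rightarrow> 'a set \<Rightarrow> real \<Rightarrow>
    (('a \<Rightarrow> nat \<Rightarrow> complex) \<times> ((nat \<Rightarrow> complex) \<Rightarrow> 'b) \<times> nat) set"
  where "CA \<gamma> \<Omega> \<delta> = {(\<phi>, \<psi>, d). d > 0 \<and> contractive_to_linf d \<phi> \<and> contractive_from_linf d \<psi> \<and>
    (\<forall>x\<in>\<Omega>. norm (\<psi> (\<phi> x) - \<gamma> x) < \<delta>)}"

definition CA_embedding :: "('a::complex_banach \<Rightarrow> 'b::complex_banach) \<Rightarrow> bool"
  where "CA_embedding \<iota> \<longleftrightarrow> clinear \<iota> \<and> (\<forall>x. norm (\<iota> x) = norm x) \<and>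
    (\<forall>\<Omega> \<delta>. finite \<Omega> \<longrightarrow> \<delta> > 0 \<longrightarrow> CA \<iota> \<Omega> \<delta> \<noteq> {})"

text \<open>
  The quantities below carry the embedding \<open>\<iota>\<close> as a parameter and are meaningful only when
  \<open>\<iota>\<close> is a CA embedding; in that case the infimum is over a nonempty set of positive integers.
\<close>

definition rc :: "('a::complex_banach \<Rightarrow> 'b::complex_banach) \<Rightarrow> 'a set \<Rightarrow> real \<Rightarrow> nat"
  where "rc \<iota> \<Omega> \<delta> = Inf {d. \<exists>\<phi> \<psi>. (\<phi>, \<psi>, d) \<in> CA \<iota> \<Omega> \<delta>}"

definition hc_at :: "('a::complex_banach \<Rightarrow> 'b::complex_banach) \<Rightarrow> ('a \<Rightarrow> 'a) \<Rightarrow> 'a set \<Rightarrow> real \<Rightarrow> ereal"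
  where "hc_at \<iota> \<alpha> \<Omega> \<delta> =
    limsup (\<lambda>n. ereal (1 / real n * ln (real (rc \<iota> (\<Union>k<n. (\<alpha> ^^ k) ` \<Omega>) \<delta>))))"

definition hc_set :: "('a::complex_banach \<Rightarrow> 'b::complex_banach) \<Rightarrow> ('a \<Rightarrow> 'a) \<Rightarrow> 'a set \<Rightarrow> ereal"
  where "hc_set \<iota> \<alpha> \<Omega> = (SUP \<delta>\<in>{0<..}. hc_at \<iota> \<alpha> \<Omega> \<delta>)"

definition hc :: "('a::complex_banach \<Rightarrow> 'b::complex_banach) \<Rightarrow> ('a \<Rightarrow> 'a) \<Rightarrow> ereal"
  where "hc \<iota> \<alpha> = (SUP \<Omega>\<in>{\<Omega>. finite \<Omega>}. hc_set \<iota> \<alpha> \<Omega>)"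


section \<open>Every Banach space has a CA embedding\<close>

text \<open>
  This section shows that \<^const>\<open>CA_embedding\<close> is never a vacuous hypothesis: the evaluation map
  into the continuous functions on the weak* dual unit ball satisfies it.
\<close>

subsection \<open>Norming functionals\<close>

definition sublinear :: "('a::real_vector \<Rightarrow> real) \<Rightarrow> bool"
  where "sublinear p \<longleftrightarrow> (\<forall>x y. p (x + y) \<le> p x + p y) \<and> (\<forall>r>0. \<forall>x. p (r *\<^sub>R x) \<le> r * p x)"

lemma sublinear_scale:
  assumes "sublinear p" "r > 0"
  shows "p (r *\<^sub>R x) = r * p x"
proof -
  have "p (inverse r *\<^sub>R (r *\<^sub>R x)) \<le> inverse r * p (r *\<^sub>R x)"
    using assms unfolding sublinear_def by (meson positive_imp_inverse_positive)
  then have "p x \<le> inverse r * p (r *\<^sub>R x)"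
    using assms by simp
  then have "r * p x \<le> p (r *\<^sub>R x)"
    using assms(2) by (simp add: field_simps)
  moreover have "p (r *\<^sub>R x) \<le> r * p x"
    using assms unfolding sublinear_def by blast
  ultimately show ?thesis by simp
qed

lemma sublinear_zero:
  assumes "sublinear p"
  shows "p 0 = 0"
  using sublinear_scale[OF assms, of 2 0] by simp

lemma sublinear_scale_nonneg:
  assumes "sublinear p" "r \<ge> 0"
  shows "p (r *\<^sub>R x) = r * p x"
  using assms sublinear_scale[of p r x] sublinear_zero[of p] by (cases "r = 0") auto

lemma sublinear_minus:
  assumes "sublinear p"
  shows "- p (- x) \<le> p x"
proof -
  have "p (x + - x) \<le> p x + p (- x)"
    using assms unfolding sublinear_def by blast
  then show ?thesis using sublinear_zero[OF assms] by simp
qed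

lemma sublinear_push:
  fixes p q :: "'a::real_vector \<Rightarrow> real" and y :: 'a
  assumes p: "sublinear p"
    and q_def: "\<And>x. q x = (INF t\<in>{0..}. p (x + t *\<^sub>R y) - t * p y)"
  shows "sublinear q" "\<And>x. q x \<le> p x" "\<And>x. q x \<le> p (x + y) - p y"
proof -
  have add: "p (u + v) \<le> p u + p v" for u v
    using p unfolding sublinear_def by blast
  have lb: "- p (- x) \<le> p (x + t *\<^sub>R y) - t * p y" if "t \<ge> 0" for x t
  proof -
    have "p (- x + (x + t *\<^sub>R y)) \<le> p (- x) + p (x + t *\<^sub>R y)"
      by (rule add)
    then show ?thesis
      using sublinear_scale_nonneg[OF p that, of y] by simp
  qed
  have bdd: "bdd_below ((\<lambda>t. p (x + t *\<^sub>R y) - t * p y) ` {0..})" for x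
    using lb[of _ x] by (intro bdd_belowI[of _ "- p (- x)"]) auto
  have le: "q x \<le> p (x + t *\<^sub>R y) - t * p y" if "t \<ge> 0" for x t
    unfolding q_def by (rule cINF_lower[OF bdd]) (use that in auto)
  show "q x \<le> p x" for x using le[of 0 x] by simp
  show "q x \<le> p (x + y) - p y" for x using le[of 1 x] by simp
  have "q (u + v) \<le> q u + q v" for u v
  proof -
    have 1: "q (u + v) - (p (v + t *\<^sub>R y) - t * p y) \<le> p (u + s *\<^sub>R y) - s * p y"
      if "s \<ge> 0" "t \<ge> 0" for s t
    proof -
      have "q (u + v) \<le> p ((u + v) + (s + t) *\<^sub>R y) - (s + t) * p y"
        using that by (intro le) auto
      also have "(u + v) + (s + t) *\<^sub>R y = (u + s *\<^sub>R y) + (v + t *\<^sub>R y)"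
        by (simp add: algebra_simps)
      also have "p \<dots> \<le> p (u + s *\<^sub>R y) + p (v + t *\<^sub>R y)"
        by (rule add)
      finally show ?thesis by (simp add: algebra_simps)
    qed
    have 2: "q (u + v) - (p (v + t *\<^sub>R y) - t * p y) \<le> q u" if "t \<ge> 0" for t
      unfolding q_def[of u] by (rule cINF_greatest) (use 1 that in auto)
    have "q (u + v) - q u \<le> p (v + t *\<^sub>R y) - t * p y" if "t \<ge> 0" for t
      using 2[OF that] by simp
    then have "q (u + v) - q u \<le> (INF t\<in>{0..}. p (v + t *\<^sub>R y) - t * p y)"
      by (intro cINF_greatest) auto
    then have "q (u + v) - q u \<le> q v" by (simp only: q_def[of v])
    then show ?thesis by simp
  qed
  moreover have "q (r *\<^sub>R x) \<le> r * q x" if r: "r > 0" for r x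
  proof -
    have "inverse r * q (r *\<^sub>R x) \<le> p (x + t *\<^sub>R y) - t * p y" if t: "t \<ge> 0" for t
    proof -
      have "q (r *\<^sub>R x) \<le> p (r *\<^sub>R x + (r * t) *\<^sub>R y) - (r * t) * p y"
        using r t by (intro le) auto
      also have "r *\<^sub>R x + (r * t) *\<^sub>R y = r *\<^sub>R (x + t *\<^sub>R y)"
        by (simp add: algebra_simps)
      also have "p \<dots> = r * p (x + t *\<^sub>R y)"
        by (rule sublinear_scale[OF p r])
      finally show ?thesis using r by (simp add: field_simps)
    qed
    then have "inverse r * q (r *\<^sub>R x) \<le> (INF t\<in>{0..}. p (x + t *\<^sub>R y) - t * p y)"
      by (intro cINF_greatest) auto
    then have "inverse r * q (r *\<^sub>R x) \<le> q x" by (simp only: q_def[of x])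
    then show ?thesis using r by (simp add: field_simps)
  qed
  ultimately show "sublinear q" unfolding sublinear_def by blast
qed

lemma sublinear_dominates_linear:
  fixes p :: "'a::real_vector \<Rightarrow> real"
  assumes p: "sublinear p"
  obtains f where "linear f" "\<And>x. f x \<le> p x"
proof -
  define A where "A = {q. sublinear q \<and> q \<le> p}"
  define P where "P = (\<lambda>q q' :: 'a \<Rightarrow> real. q' \<le> q)"
  have "\<exists>m\<in>A. \<forall>a\<in>A. P m a \<longrightarrow> a = m"
  proof (rule predicate_Zorn)
    show "partial_order_on A (relation_of P A)"
      unfolding P_def by (rule partial_order_on_relation_ofI) auto
  next
    fix C assume C: "C \<in> Chains (relation_of P A)"
    then have CsubA: "C \<subseteq> A" and ch: "\<And>a b. a \<in> C \<Longrightarrow> b \<in> C \<Longrightarrow> a \<le> b \<or> b \<le> a"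
      unfolding Chains_def relation_of_def P_def by auto
    show "\<exists>u\<in>A. \<forall>a\<in>C. P a u"
    proof (cases "C = {}")
      case True
      then show ?thesis using p by (auto simp: A_def)
    next
      case False
      define u where "u x = (INF q\<in>C. q x)" for x
      have sub: "sublinear q" and qp: "\<And>x. q x \<le> p x" if "q \<in> C" for q
        using CsubA that by (auto simp: A_def le_fun_def)
      have lb: "- p (- x) \<le> q x" if "q \<in> C" for q x
        using sublinear_minus[OF sub[OF that], of x] qp[OF that, of "- x"] by linarith
      have bdd: "bdd_below ((\<lambda>q. q x) ` C)" for x
        using lb[of _ x] by (intro bdd_belowI[of _ "- p (- x)"]) auto
      have le: "u x \<le> q x" if "q \<in> C" for q x
        unfolding u_def by (rule cINF_lower[OF bdd that])
      have "u (x + y) \<le> u x + u y" for x y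
      proof -
        have 1: "u (x + y) - q y \<le> q' x" if q: "q \<in> C" "q' \<in> C" for q q'
        proof -
          obtain r where r: "r \<in> C" "r \<le> q" "r \<le> q'"
            using ch[OF q] q by blast
          have "u (x + y) \<le> r (x + y)" by (rule le[OF r(1)])
          also have "\<dots> \<le> r x + r y" using sub[OF r(1)] unfolding sublinear_def by blast
          also have "\<dots> \<le> q' x + q y" using r by (intro add_mono) (auto simp: le_fun_def)
          finally show ?thesis by simp
        qed
        have "u (x + y) - q y \<le> u x" if "q \<in> C" for q
          unfolding u_def[of x] by (rule cINF_greatest[OF False]) (use 1 that in auto)
        then have "u (x + y) - u x \<le> u y"
          unfolding u_def[of y] by (intro cINF_greatest[OF False]) (auto simp: algebra_simps)
        then show ?thesis by simp
      qed
      moreover have "u (r *\<^sub>R x) \<le> r * u x" if r: "r > 0" for r x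
      proof -
        have "inverse r * u (r *\<^sub>R x) \<le> q x" if "q \<in> C" for q
          using le[OF that, of "r *\<^sub>R x"] sublinear_scale[OF sub[OF that] r, of x] r
          by (simp add: field_simps)
        then have "inverse r * u (r *\<^sub>R x) \<le> u x"
          unfolding u_def[of x] by (intro cINF_greatest[OF False])
        then show ?thesis using r by (simp add: field_simps)
      qed
      moreover have "u \<le> p"
      proof (rule le_funI)
        fix x
        obtain q where "q \<in> C" using False by blast
        then show "u x \<le> p x" using le[of q x] qp[of q x] by linarith
      qed
      ultimately have "u \<in> A" unfolding A_def sublinear_def by blast
      then show ?thesis using le by (auto simp: P_def le_fun_def)
    qed
  qed
  then obtain m where m: "sublinear m" "m \<le> p"
    and min: "\<And>a. sublinear a \<Longrightarrow> a \<le> p \<Longrightarrow> a \<le> m \<Longrightarrow> a = m"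
    unfolding A_def P_def by auto
  have add: "m (x + y) = m x + m y" for x y
  proof -
    define q where "q x = (INF t\<in>{0..}. m (x + t *\<^sub>R y) - t * m y)" for x
    note push = sublinear_push[OF m(1) q_def]
    have "q = m"
    proof (rule min)
      show "q \<le> m" using push(2) by (auto simp: le_fun_def)
      then show "q \<le> p" using m(2) by (rule order_trans)
    qed (rule push(1))
    then have "m x + m y \<le> m (x + y)" using push(3)[of x] by simp
    moreover have "m (x + y) \<le> m x + m y" using m(1) unfolding sublinear_def by blast
    ultimately show ?thesis by simp
  qed
  have neg: "m (- x) = - m x" for x
    using add[of x "- x"] sublinear_zero[OF m(1)] by simp
  have "m (r *\<^sub>R x) = r * m x" for r x
  proof (cases "r \<ge> 0")
    case True
    then show ?thesis by (rule sublinear_scale_nonneg[OF m(1)])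
  next
    case False
    then have "m ((- r) *\<^sub>R x) = (- r) * m x" by (intro sublinear_scale_nonneg[OF m(1)]) auto
    then show ?thesis using neg[of "r *\<^sub>R x"] by simp
  qed
  then have "linear m" using add by (intro linearI) auto
  then show ?thesis using that m(2) by (auto simp: le_fun_def)
qed

lemma clinear_scaleR: "clinear f \<Longrightarrow> f (r *\<^sub>R x) = r *\<^sub>R f x"
  unfolding clinear_def by (metis scaleC_of_real)

lemma clinear_imp_linear: "clinear f \<Longrightarrow> linear f"
  by (rule linearI) (simp_all add: clinear_scaleR, simp add: clinear_def)

lemma norming_functional:
  fixes x0 :: "'a::complex_normed_vector"
  obtains g where "g \<in> complex_dual" "norm g \<le> 1" "cmod (blinfun_apply g x0) = norm x0"
proof -
  have sn: "sublinear (norm :: 'a \<Rightarrow> real)"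
    unfolding sublinear_def by (auto intro: norm_triangle_ineq)
  define q where "q x = (INF t\<in>{0..}. norm (x + t *\<^sub>R x0) - t * norm x0)" for x
  note push = sublinear_push[OF sn q_def]
  obtain f where f: "linear f" "\<And>x. f x \<le> q x"
    using sublinear_dominates_linear[OF push(1)] by blast
  have fn: "f x \<le> norm x" for x
    using f(2)[of x] push(2)[of x] by linarith
  have "f (- x0) \<le> - norm x0"
    using f(2)[of "- x0"] push(3)[of "- x0"] by simp
  then have fx0: "f x0 = norm x0"
    using fn[of x0] by (simp add: linear_neg[OF f(1)])
  define g where "g = (\<lambda>x. Complex (f x) (- f (\<i> *\<^sub>C x)))"
  have decomp: "c *\<^sub>C x = Re c *\<^sub>R x + Im c *\<^sub>R (\<i> *\<^sub>C x)" for c and x :: 'a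
  proof -
    have "c *\<^sub>C x = (complex_of_real (Re c) + complex_of_real (Im c) * \<i>) *\<^sub>C x"
      using complex_eq[of c] by (simp add: mult.commute)
    then show ?thesis by (simp only: scaleC_add_left scaleC_scaleC[symmetric] scaleC_of_real)
  qed
  have ii: "\<i> *\<^sub>C (\<i> *\<^sub>C x) = - x" for x :: 'a
    using scaleC_of_real[of "-1" x] by (simp add: scaleC_scaleC)
  have gadd: "g (x + y) = g x + g y" for x y
    by (simp add: g_def complex_eq_iff scaleC_add_right linear_add[OF f(1)])
  have gmul: "g (c *\<^sub>C x) = c * g x" for c x
  proof -
    have 1: "f (c *\<^sub>C x) = Re c * f x + Im c * f (\<i> *\<^sub>C x)"
      by (subst decomp) (simp add: linear_add[OF f(1)] linear_scale[OF f(1)])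
    have "\<i> *\<^sub>C (c *\<^sub>C x) = c *\<^sub>C (\<i> *\<^sub>C x)" by (simp add: scaleC_scaleC mult.commute)
    also have "\<dots> = Re c *\<^sub>R (\<i> *\<^sub>C x) + Im c *\<^sub>R (- x)" by (subst decomp) (simp add: ii)
    finally have 2: "f (\<i> *\<^sub>C (c *\<^sub>C x)) = Re c * f (\<i> *\<^sub>C x) - Im c * f x"
      by (simp add: linear_add[OF f(1)] linear_scale[OF f(1)] linear_diff[OF f(1)])
    show ?thesis by (simp add: g_def complex_eq_iff 1 2 algebra_simps)
  qed
  have cl: "clinear g" unfolding clinear_def by (simp add: gadd gmul scaleC_complex_def)
  have gn: "cmod (g x) \<le> norm x" for x
  proof (cases "g x = 0")
    case True
    then show ?thesis by simp
  next
    case False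
    define c where "c = cnj (g x) / cmod (g x)"
    have c1: "cmod c = 1" using False by (simp add: c_def norm_divide)
    have "g (c *\<^sub>C x) = complex_of_real (cmod (g x))"
      using False by (simp add: gmul c_def mult.commute[of "cnj _"] complex_norm_square[symmetric] power2_eq_square)
    then have "cmod (g x) = f (c *\<^sub>C x)" by (simp add: g_def complex_eq_iff)
    also have "\<dots> \<le> norm (c *\<^sub>C x)" by (rule fn)
    finally show ?thesis by (simp add: norm_scaleC c1)
  qed
  have bl: "bounded_linear g"
    using clinear_imp_linear[OF cl] gn
    by (intro bounded_linear.intro bounded_linear_axioms.intro) (auto intro!: exI[of _ 1])
  have ap: "blinfun_apply (Blinfun g) = g" using bl by (rule bounded_linear_Blinfun_apply)
  have "norm x0 \<le> cmod (g x0)" using complex_Re_le_cmod[of "g x0"] by (simp add: g_def fx0)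
  then have "cmod (g x0) = norm x0" using gn[of x0] by linarith
  moreover have "norm (Blinfun g) \<le> 1" by (rule norm_blinfun_bound) (use gn ap in auto)
  ultimately show ?thesis using that[of "Blinfun g"] cl ap by (simp add: complex_dual_def)
qed

subsection \<open>The weak* dual unit ball and its space of continuous functions\<close>

typedef (overloaded) ('a::complex_normed_vector) dual_ball =
  "{f \<in> complex_dual. norm f \<le> 1} :: ('a \<Rightarrow>\<^sub>L complex) set"
  by (rule exI[of _ 0]) (simp add: complex_dual_def clinear_def scaleC_complex_def)

definition dual_eval :: "'a::complex_normed_vector dual_ball \<Rightarrow> 'a \<Rightarrow> complex"
  where "dual_eval f = blinfun_apply (Rep_dual_ball f)"

text \<open>
  The weak* topology, i.e. the one pulled back from the topology of pointwise convergence
  (the product topology) on \<open>'a \<Rightarrow> complex\<close>.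
\<close>

instantiation dual_ball :: (complex_normed_vector) topological_space
begin

definition open_dual_ball :: "'a dual_ball set \<Rightarrow> bool"
  where "open_dual_ball U \<longleftrightarrow> (\<exists>V. open V \<and> U = dual_eval -` V)"

instance
proof
  show "open (UNIV :: 'a dual_ball set)"
    unfolding open_dual_ball_def by (rule exI[of _ UNIV]) simp
next
  fix S T :: "'a dual_ball set"
  assume "open S" "open T"
  then obtain V W where "open V" "S = dual_eval -` V" "open W" "T = dual_eval -` W"
    unfolding open_dual_ball_def by blast
  then show "open (S \<inter> T)"
    unfolding open_dual_ball_def by (intro exI[of _ "V \<inter> W"]) auto
next
  fix K :: "'a dual_ball set set"
  assume "\<forall>S\<in>K. open S"
  then have "\<forall>S\<in>K. \<exists>V. open V \<and> S = dual_eval -` V"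
    unfolding open_dual_ball_def .
  then obtain V where V: "\<forall>S\<in>K. open (V S) \<and> S = dual_eval -` V S"
    by (rule bchoice[THEN exE])
  then have "\<Union>K = dual_eval -` (\<Union>S\<in>K. V S)"
    by (auto simp only: vimage_UN)
  moreover have "open (\<Union>S\<in>K. V S)"
    using V by (intro open_UN) simp
  ultimately show "open (\<Union>K)"
    unfolding open_dual_ball_def by blast
qed

end

lemma dual_eval_add: "dual_eval f (x + y) = dual_eval f x + dual_eval f y"
  and dual_eval_scaleC: "dual_eval f (c *\<^sub>C x) = c * dual_eval f x"
  and dual_eval_norm: "cmod (dual_eval f x) \<le> norm x"
proof -
  have "clinear (dual_eval f)" and n: "norm (Rep_dual_ball f) \<le> 1"
    using Rep_dual_ball[of f] by (auto simp: complex_dual_def dual_eval_def)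
  then show "dual_eval f (x + y) = dual_eval f x + dual_eval f y"
    and "dual_eval f (c *\<^sub>C x) = c * dual_eval f x"
    by (auto simp: clinear_def scaleC_complex_def)
  have "cmod (dual_eval f x) \<le> norm (Rep_dual_ball f) * norm x"
    unfolding dual_eval_def by (rule norm_blinfun)
  also have "\<dots> \<le> 1 * norm x" using n by (intro mult_right_mono) auto
  finally show "cmod (dual_eval f x) \<le> norm x" by simp
qed

lemma continuous_on_dual_eval: "continuous_on UNIV (\<lambda>f. dual_eval f x)"
proof -
  have "continuous_on UNIV (dual_eval :: 'a dual_ball \<Rightarrow> _)"
    unfolding continuous_on_open_vimage[OF open_UNIV] by (auto simp: open_dual_ball_def)
  then show ?thesis by (rule continuous_on_product_then_coordinatewise)
qed

text \<open>The library has this instance for metric domains only.\<close>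

instance bcontfun :: (topological_space, complete_space) complete_space
proof
  fix f :: "nat \<Rightarrow> ('a, 'b) bcontfun"
  assume "Cauchy f"
  then obtain g where "uniform_limit UNIV f g sequentially"
    using uniformly_convergent_eq_cauchy[of "\<lambda>_. True" f]
    unfolding Cauchy_def uniform_limit_sequentially_iff
    by (metis dist_fun_lt_imp_dist_val_lt)
  from uniform_limit_bcontfunE[OF this sequentially_bot]
  obtain l' where "g = apply_bcontfun l'" "(f \<longlonglongrightarrow> l')" by metis
  then show "convergent f"
    by (intro convergentI)
qed

instance bcontfun :: (topological_space, banach) banach ..

instantiation bcontfun :: (topological_space, complex_normed_vector) complex_normed_vector
begin

definition scaleC_bcontfun :: "complex \<Rightarrow> ('a, 'b) bcontfun \<Rightarrow> ('a, 'b) bcontfun"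
  where "scaleC_bcontfun c f = Bcontfun (\<lambda>x. c *\<^sub>C apply_bcontfun f x)"

lemma apply_bcontfun_scaleC:
  fixes f :: "('a, 'b) bcontfun"
  shows "apply_bcontfun (c *\<^sub>C f) x = c *\<^sub>C apply_bcontfun f x"
proof -
  have "bounded_linear ((*\<^sub>C) c :: 'b \<Rightarrow> 'b)"
  proof (rule bounded_linear_intro[where K = "cmod c"])
    fix x y :: 'b and r :: real
    show "c *\<^sub>C (x + y) = c *\<^sub>C x + c *\<^sub>C y" by (rule scaleC_add_right)
    show "c *\<^sub>C (r *\<^sub>R x) = r *\<^sub>R (c *\<^sub>C x)"
      by (metis scaleC_of_real scaleC_scaleC mult.commute)
    show "norm (c *\<^sub>C x) \<le> norm x * cmod c" by (simp add: norm_scaleC)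
  qed
  then have "continuous_on UNIV (\<lambda>x. c *\<^sub>C apply_bcontfun f x)"
    by (rule bounded_linear.continuous_on) (rule continuous_on_apply_bcontfun)
  then have "(\<lambda>x. c *\<^sub>C apply_bcontfun f x) \<in> bcontfun"
    by (rule bcontfun_normI[where b = "cmod c * norm f"])
      (simp add: norm_scaleC mult_left_mono norm_bounded)
  then show ?thesis by (simp add: scaleC_bcontfun_def Bcontfun_inverse)
qed

instance
proof
  fix a b :: complex and r :: real and x y :: "('a, 'b) bcontfun"
  show "a *\<^sub>C (x + y) = a *\<^sub>C x + a *\<^sub>C y"
    by (rule bcontfun_eqI) (simp add: apply_bcontfun_scaleC scaleC_add_right)
  show "(a + b) *\<^sub>C x = a *\<^sub>C x + b *\<^sub>C x"
    by (rule bcontfun_eqI) (simp add: apply_bcontfun_scaleC scaleC_add_left)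
  show "a *\<^sub>C (b *\<^sub>C x) = (a * b) *\<^sub>C x"
    by (rule bcontfun_eqI) (simp add: apply_bcontfun_scaleC scaleC_scaleC)
  show "complex_of_real r *\<^sub>C x = r *\<^sub>R x"
    by (rule bcontfun_eqI) (simp add: apply_bcontfun_scaleC scaleC_of_real)
  have le: "norm (c *\<^sub>C z) \<le> cmod c * norm z" for c and z :: "('a, 'b) bcontfun"
    by (rule norm_bound) (auto simp: apply_bcontfun_scaleC norm_scaleC intro!: mult_left_mono norm_bounded)
  show "norm (a *\<^sub>C x) = cmod a * norm x"
  proof (cases "a = 0")
    case True
    then show ?thesis using le[of a x] by simp
  next
    case False
    have "inverse a *\<^sub>C (a *\<^sub>C x) = x"
      using False scaleC_of_real[of 1] by (intro bcontfun_eqI) (simp add: apply_bcontfun_scaleC scaleC_scaleC)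
    then have "norm x \<le> inverse (cmod a) * norm (a *\<^sub>C x)"
      using le[of "inverse a" "a *\<^sub>C x"] by (simp add: norm_inverse)
    then have "cmod a * norm x \<le> norm (a *\<^sub>C x)" using False by (simp add: field_simps)
    then show ?thesis using le[of a x] by simp
  qed
qed

end

instance bcontfun :: (topological_space, complex_banach) complex_banach ..

definition eval_map :: "'a::complex_normed_vector \<Rightarrow> ('a dual_ball \<Rightarrow>\<^sub>C complex)"
  where "eval_map x = Bcontfun (\<lambda>f. dual_eval f x)"

lemma apply_eval_map: "apply_bcontfun (eval_map x) f = dual_eval f x"
proof -
  have "(\<lambda>f. dual_eval f x) \<in> bcontfun"
    by (rule bcontfun_normI[OF continuous_on_dual_eval dual_eval_norm])
  then show ?thesis by (simp add: eval_map_def Bcontfun_inverse)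
qed

lemma norm_eval_map: "norm (eval_map x) = norm x"
proof (rule antisym)
  show "norm (eval_map x) \<le> norm x"
    by (rule norm_bound) (simp add: apply_eval_map dual_eval_norm)
  obtain g where g: "g \<in> complex_dual" "norm g \<le> 1" "cmod (blinfun_apply g x) = norm x"
    using norming_functional .
  then have "dual_eval (Abs_dual_ball g) x = blinfun_apply g x"
    by (simp add: dual_eval_def Abs_dual_ball_inverse)
  then show "norm x \<le> norm (eval_map x)"
    using norm_bounded[of "eval_map x" "Abs_dual_ball g"] g(3) by (simp add: apply_eval_map)
qed

subsection \<open>Approximation through a partition of unity\<close>

lemma dual_ball_finite_net:
  fixes \<Omega> :: "'a::complex_normed_vector set"
  assumes "finite \<Omega>" "\<delta> > 0"
  obtains F :: "'a dual_ball set"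
  where "finite F" "F \<noteq> {}" "\<And>f. \<exists>g\<in>F. \<forall>x\<in>\<Omega>. cmod (dual_eval f x - dual_eval g x) < \<delta>"
proof -
  define \<epsilon> where "\<epsilon> = \<delta> / 2"
  have \<epsilon>: "\<epsilon> > 0" using assms by (simp add: \<epsilon>_def)
  define code where "code = (\<lambda>z. (\<lfloor>Re z / \<epsilon>\<rfloor>, \<lfloor>Im z / \<epsilon>\<rfloor>))"
  define h where "h = (\<lambda>f :: 'a dual_ball. \<lambda>x\<in>\<Omega>. code (dual_eval f x))"
  define B where "B = (\<lambda>x::'a. {\<lfloor>- norm x / \<epsilon>\<rfloor>..\<lfloor>norm x / \<epsilon>\<rfloor>})"
  have "code (dual_eval f x) \<in> B x \<times> B x" for f x
  proof -
    have "\<bar>Re (dual_eval f x)\<bar> \<le> norm x" "\<bar>Im (dual_eval f x)\<bar> \<le> norm x"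
      using dual_eval_norm[of f x] abs_Re_le_cmod[of "dual_eval f x"] abs_Im_le_cmod[of "dual_eval f x"]
      by linarith+
    then show ?thesis
      using \<epsilon> unfolding code_def B_def by (auto intro!: floor_mono simp: field_simps abs_le_iff)
  qed
  then have "range h \<subseteq> (\<Pi>\<^sub>E x\<in>\<Omega>. B x \<times> B x)" by (auto simp: h_def)
  moreover have "finite (\<Pi>\<^sub>E x\<in>\<Omega>. B x \<times> B x)"
    using assms(1) by (intro finite_PiE) (auto simp: B_def)
  ultimately have fin: "finite (range h)" by (rule finite_subset)
  have hx: "h f x = code (dual_eval f x)" if "x \<in> \<Omega>" for f x
    using that by (simp add: h_def)
  have fl: "\<bar>a - b\<bar> < \<epsilon>" if "\<lfloor>a / \<epsilon>\<rfloor> = \<lfloor>b / \<epsilon>\<rfloor>" for a b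
  proof -
    have "\<bar>a / \<epsilon> - b / \<epsilon>\<bar> < 1"
      using that floor_correct[of "a / \<epsilon>"] floor_correct[of "b / \<epsilon>"] by linarith
    then have "\<bar>(a - b) / \<epsilon>\<bar> < 1" by (simp add: diff_divide_distrib)
    then show ?thesis using \<epsilon> by (simp add: abs_divide)
  qed
  have close: "cmod (z - w) < \<delta>" if "code z = code w" for z w
  proof -
    have "\<bar>Re (z - w)\<bar> < \<epsilon>" "\<bar>Im (z - w)\<bar> < \<epsilon>"
      using that by (auto simp: code_def intro: fl)
    then show ?thesis using cmod_le[of "z - w"] by (simp add: \<epsilon>_def)
  qed
  show ?thesis
  proof (rule that[of "inv h ` range h"])
    show "finite (inv h ` range h)" using fin by simp
    show "inv h ` range h \<noteq> {}" by simp
    fix f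
    have "h (inv h (h f)) = h f" by (simp add: f_inv_into_f)
    then have "h (inv h (h f)) x = h f x" for x by (rule arg_cong)
    then have "code (dual_eval f x) = code (dual_eval (inv h (h f)) x)" if "x \<in> \<Omega>" for x
      using that hx by metis
    then have "\<forall>x\<in>\<Omega>. cmod (dual_eval f x - dual_eval (inv h (h f)) x) < \<delta>"
      by (intro ballI close)
    then show "\<exists>g\<in>inv h ` range h. \<forall>x\<in>\<Omega>. cmod (dual_eval f x - dual_eval g x) < \<delta>"
      by (intro bexI[of _ "inv h (h f)"]) simp_all
  qed
qed

lemma linf_norm_bound: "d > 0 \<Longrightarrow> i < d \<Longrightarrow> cmod (v i) \<le> linf_norm d v"
  unfolding linf_norm_def by (intro Max_ge) auto

lemma CA_eval_map_nonempty:
  fixes \<Omega> :: "'a::complex_normed_vector set"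
  assumes "finite \<Omega>" "\<delta> > 0"
  shows "CA (eval_map :: 'a \<Rightarrow> _) \<Omega> \<delta> \<noteq> {}"
proof -
  define \<eta> where "\<eta> = \<delta> / 2"
  have \<eta>: "\<eta> > 0" "\<eta> < \<delta>" using assms by (auto simp: \<eta>_def)
  obtain F :: "'a dual_ball set" where F: "finite F" "F \<noteq> {}"
    "\<And>f. \<exists>g\<in>F. \<forall>x\<in>\<Omega>. cmod (dual_eval f x - dual_eval g x) < \<eta>"
    using dual_ball_finite_net[OF assms(1) \<eta>(1)] by blast
  define d where "d = card F"
  have d: "d > 0" using F by (simp add: d_def card_gt_0_iff)
  obtain e where "bij_betw e {0..<d} F"
    using ex_bij_betw_nat_finite[OF F(1)] unfolding d_def by blast
  then have e: "e ` {..<d} = F" by (simp add: bij_betw_def atLeast0LessThan)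
  define w where "w i f = (\<Prod>x\<in>\<Omega>. max 0 (\<eta> - cmod (dual_eval f x - dual_eval (e i) x)))" for i f
  define S where "S f = (\<Sum>i<d. w i f)" for f
  define g where "g i f = w i f / S f" for i f
  have w0: "w i f \<ge> 0" for i f unfolding w_def by (intro prod_nonneg) auto
  have S0: "S f > 0" for f
  proof -
    obtain i where i: "i < d" "\<forall>x\<in>\<Omega>. cmod (dual_eval f x - dual_eval (e i) x) < \<eta>"
      using F(3)[of f] unfolding e[symmetric] by auto
    then have "w i f > 0" unfolding w_def by (intro prod_pos) auto
    then show ?thesis unfolding S_def using i(1) w0 by (intro sum_pos2[of _ i]) auto
  qed
  have cw: "continuous_on UNIV (w i)" for i
    unfolding w_def[abs_def] by (intro continuous_intros continuous_on_dual_eval)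
  have cg: "continuous_on UNIV (g i)" for i
    unfolding g_def[abs_def] S_def[abs_def]
    using S0 by (intro continuous_intros cw) (auto simp: S_def less_le)
  have g0: "g i f \<ge> 0" for i f using w0 S0 by (simp add: g_def less_imp_le)
  have g1: "(\<Sum>i<d. g i f) = 1" for f
    using S0[of f] by (simp add: g_def sum_divide_distrib[symmetric] S_def[symmetric])
  have gclose: "cmod (dual_eval f x - dual_eval (e i) x) \<le> \<eta>" if "g i f \<noteq> 0" "x \<in> \<Omega>" for i f x
  proof (rule ccontr)
    assume "\<not> ?thesis"
    then have "max 0 (\<eta> - cmod (dual_eval f x - dual_eval (e i) x)) = 0" by simp
    then have "w i f = 0" unfolding w_def using that(2) assms(1) by (intro prod_zero) auto
    then show False using that(1) by (simp add: g_def)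
  qed
  have avg: "cmod (\<Sum>i<d. v i * g i f) \<le> b" if "\<And>i. i < d \<Longrightarrow> g i f \<noteq> 0 \<Longrightarrow> cmod (v i) \<le> b" for v :: "nat \<Rightarrow> complex" and f b
  proof -
    have "cmod (\<Sum>i<d. v i * g i f) \<le> (\<Sum>i<d. b * g i f)"
    proof (rule sum_norm_le)
      fix i assume "i \<in> {..<d}"
      then show "cmod (v i * g i f) \<le> b * g i f"
        using that[of i] g0[of i f] by (cases "g i f = 0") (auto simp: norm_mult intro: mult_right_mono)
    qed
    also have "\<dots> = b" by (simp add: sum_distrib_left[symmetric] g1)
    finally show ?thesis .
  qed
  define \<phi> where "\<phi> x i = (if i < d then dual_eval (e i) x else 0)" for x i
  define \<psi> where "\<psi> v = Bcontfun (\<lambda>f. \<Sum>i<d. v i * g i f)" for v :: "nat \<Rightarrow> complex"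
  have \<psi>: "apply_bcontfun (\<psi> v) f = (\<Sum>i<d. v i * g i f)" for v :: "nat \<Rightarrow> complex" and f
  proof -
    have "(\<lambda>f. \<Sum>i<d. v i * g i f) \<in> bcontfun"
      by (rule bcontfun_normI[where b = "linf_norm d v"])
        (auto intro!: continuous_intros cg avg linf_norm_bound d)
    then show ?thesis by (simp add: \<psi>_def Bcontfun_inverse)
  qed
  have "linf_norm d (\<phi> x) \<le> norm x" for x
    using d unfolding linf_norm_def
    by (subst Max_le_iff) (auto simp: \<phi>_def dual_eval_norm)
  then have "contractive_to_linf d \<phi>"
    unfolding contractive_to_linf_def
    by (auto simp: linf_def \<phi>_def fun_eq_iff dual_eval_add dual_eval_scaleC)
  moreover have "contractive_from_linf d \<psi>"
    unfolding contractive_from_linf_def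
    by (auto intro!: bcontfun_eqI norm_bound avg linf_norm_bound d
        simp: \<psi> apply_bcontfun_scaleC scaleC_complex_def sum_distrib_left sum.distrib algebra_simps)
  moreover have "norm (\<psi> (\<phi> x) - eval_map x) < \<delta>" if "x \<in> \<Omega>" for x
  proof -
    have "norm (\<psi> (\<phi> x) - eval_map x) \<le> \<eta>"
    proof (rule norm_bound)
      fix f
      have "(\<Sum>i<d. dual_eval f x * g i f) = dual_eval f x"
        using arg_cong[OF g1[of f], of complex_of_real] by (simp add: sum_distrib_left[symmetric])
      then have "apply_bcontfun (\<psi> (\<phi> x) - eval_map x) f
          = (\<Sum>i<d. (dual_eval (e i) x - dual_eval f x) * g i f)"
        by (simp add: \<psi> apply_eval_map \<phi>_def left_diff_distrib sum_subtractf)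
      also have "cmod \<dots> \<le> \<eta>"
        using gclose[OF _ that] by (intro avg) (simp add: norm_minus_commute)
      finally show "norm (apply_bcontfun (\<psi> (\<phi> x) - eval_map x) f) \<le> \<eta>" .
    qed
    then show ?thesis using \<eta>(2) by linarith
  qed
  ultimately have "(\<phi>, \<psi>, d) \<in> CA eval_map \<Omega> \<delta>" using d by (simp add: CA_def)
  then show ?thesis by blast
qed

theorem CA_embedding_eval_map: "CA_embedding (eval_map :: 'a::complex_banach \<Rightarrow> _)"
proof -
  have "clinear (eval_map :: 'a \<Rightarrow> _)"
    unfolding clinear_def
    by (auto intro!: bcontfun_eqI
        simp: apply_eval_map apply_bcontfun_scaleC dual_eval_add dual_eval_scaleC scaleC_complex_def)
  then show ?thesis
    unfolding CA_embedding_def using norm_eval_map CA_eval_map_nonempty by blast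
qed

end

theory Submission
  imports Defs
begin

text \<open>
  Write \<open>K\<close> for the unit ball of \<open>X\<^sup>*\<close> with the weak* topology, and let \<open>\<alpha>\<close> act on it by
  \<open>f \<mapsto> f \<circ> \<alpha>\<close>. The proof has two halves: the CA entropy of \<open>\<alpha>\<close> is bounded by the topological
  entropy of this action, and that topological entropy vanishes when \<open>X\<^sup>*\<close> is norm separable.

  \<^bold>\<open>From CA rank to covering numbers.\<close> Let \<open>\<psi>\<^sub>1 \<circ> \<phi>\<^sub>1\<close> be any approximate factorization of \<open>\<iota>\<close>
  through some \<open>\<ell>\<^sub>\<infinity>\<^bsup>d\<^esup>\<close>, with no control on \<open>d\<close>. The coordinates of \<open>\<phi>\<^sub>1\<close> are \<open>d\<close> functionals
  in \<open>K\<close>. Replacing each of them by a nearby member of a finite net \<open>G\<close> of \<open>K\<close>, where nearness is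
  measured on \<open>\<Omega>\<close>, makes many coordinates coincide, and the factorization then passes through
  \<open>\<ell>\<^sub>\<infinity>\<close> of dimension \<open>card G\<close>. This is \<open>rc_le_card_net\<close>. For the set
  \<open>\<Omega> \<union> \<dots> \<union> \<alpha>\<^bsup>n-1\<^esup>\<Omega>\<close> a net is obtained by choosing a point in each cell of a covering of \<open>K\<close>
  by \<open>n\<close>-step itineraries through small weak* open sets, so it suffices that the
  number of itineraries needed grows subexponentially in \<open>n\<close>.

  \<^bold>\<open>Zero topological entropy.\<close> By separability, \<open>K\<close> is covered by countably many closed norm balls
  \<open>D j\<close> of small radius, and these are weak* closed. As \<open>\<alpha>\<close> is isometric, the whole orbit of a point of \<open>D j\<close>, past and
  future, is shadowed by the orbit of the centre: a point known to enter \<open>D j\<close> at a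
  given time has its itinerary determined. Suppose that coverings of \<open>K\<close> grew
  at least like \<open>r\<^sup>n\<close> with \<open>r > 1\<close>. By Zorn's lemma and compactness there is a minimal closed
  invariant set \<open>A \<subseteq> K\<close> with this growth (\<open>maximal_thick_complement\<close>). By Baire's theorem some
  \<open>D j\<close> contains a nonempty relatively open part of \<open>A\<close>. The points of \<open>A\<close> that never visit this
  part form a smaller closed invariant set \<open>A'\<close>, so some neighbourhood \<open>U\<close> of \<open>A'\<close> is covered by
  \<open>m < r\<^sup>k\<close> itineraries of length \<open>k\<close>. A point of \<open>A\<close> either stays in \<open>U\<close> up to time \<open>q k\<close>, which
  allows \<open>m\<^bsup>q\<^esup>\<close> itineraries, or leaves \<open>U\<close> and hence, by compactness of
  \<open>A - U\<close>, visits \<open>D j\<close> within a bounded distance in time from leaving, which allows only a number of itineraries linear in \<open>q\<close>. For large \<open>q\<close> the total is below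
  \<open>r\<^bsup>q k\<^esup>\<close>, a contradiction (\<open>subexponential_cells_cover\<close>).
\<close>

section \<open>Two facts from general topology\<close>

lemma Hausdorff_space_fun:
  "Hausdorff_space (euclidean :: ('a \<Rightarrow> 'b::t2_space) topology)"
proof -
  have "Hausdorff_space (euclidean :: 'b topology)"
    using hausdorff by (auto simp: Hausdorff_space_def disjnt_def)
  then show ?thesis
    by (simp add: euclidean_product_topology[symmetric] Hausdorff_space_product_topology)
qed

lemma Baire_closed_cover:
  fixes A :: "'p::topological_space set" and D :: "nat \<Rightarrow> 'p set"
  assumes "Hausdorff_space (euclidean :: 'p topology)" "compact A" "A \<noteq> {}" 
    "\<And>j. closed (D j)" "A \<subseteq> (\<Union>j. D j)"
  obtains j W where "open W" "A \<inter> W \<noteq> {}" "A \<inter> W \<subseteq> D j"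
proof -
  let ?X = "top_of_set A"
  have "compact_space ?X"
    using assms(2) by (simp add: compact_space_subtopology)
  moreover have "Hausdorff_space ?X"
    using assms(1) by (rule Hausdorff_space_subtopology)
  ultimately have X: "locally_compact_space ?X \<and> regular_space ?X"
    by (simp add: compact_imp_locally_compact_space compact_Hausdorff_imp_regular_space)
  have "(\<Union>j. A \<inter> D j) = A" using assms(5) by blast
  then have "?X interior_of (\<Union>j. A \<inter> D j) \<noteq> {}"
    using interior_of_topspace[of ?X] assms(3) by simp
  moreover have "?X interior_of (\<Union>j. A \<inter> D j) = {}" if "\<And>j. ?X interior_of (A \<inter> D j) = {}"
    using X assms(4) that by (intro Baire_category_alt) (auto simp: closedin_closed_Int)
  ultimately have "\<exists>j. ?X interior_of (A \<inter> D j) \<noteq> {}" by blast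
  then obtain j p where "p \<in> ?X interior_of (A \<inter> D j)" by blast
  then obtain G where "openin ?X G" "p \<in> G" "G \<subseteq> A \<inter> D j"
    by (auto simp: interior_of_def)
  then show ?thesis using that by (auto simp: openin_open)
qed

section \<open>Itineraries of a flow and their number\<close>

definition cell :: "(int \<Rightarrow> 'p \<Rightarrow> 'p) \<Rightarrow> nat \<Rightarrow> (nat \<Rightarrow> 'p set) \<Rightarrow> 'p set"
  where "cell T n w = {p. \<forall>k<n. T (int k) p \<in> w k}"

text \<open>
  The least \<open>m\<close> for \<open>A = K\<close> and \<open>\<U>\<close> an open cover of \<open>K\<close> is the number \<open>N(\<U> \<or> T\<^bsup>-1\<^esup>\<U> \<or> \<dots> \<or> T\<^bsup>-(n-1)\<^esup>\<U>)\<close> whose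
  exponential growth rate is the topological entropy of \<open>T\<close> relative to \<open>\<U>\<close>. Words are functions
  on all of \<open>nat\<close>; only their first \<open>n\<close> letters matter.
\<close>

definition cells_cover ::
    "(int \<Rightarrow> 'p \<Rightarrow> 'p) \<Rightarrow> 'p set set \<Rightarrow> nat \<Rightarrow> nat \<Rightarrow> 'p set \<Rightarrow> bool"
  where "cells_cover T \<U> n m A \<longleftrightarrow> (\<exists>W. finite W \<and> card W \<le> m \<and>
    (\<forall>w\<in>W. \<forall>k<n. w k \<in> \<U>) \<and> A \<subseteq> (\<Union>w\<in>W. cell T n w))"

lemma cells_cover_subset: "cells_cover T \<U> n m A \<Longrightarrow> B \<subseteq> A \<Longrightarrow> cells_cover T \<U> n m B"
  unfolding cells_cover_def by (meson order_trans)

lemma cells_cover_mono: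
  assumes "cells_cover T \<U> n m A" "n' \<le> n" "m \<le> m'"
  shows "cells_cover T \<U> n' m' A"
proof -
  obtain W where W: "finite W" "card W \<le> m" "\<forall>w\<in>W. \<forall>k<n. w k \<in> \<U>" "A \<subseteq> (\<Union>w\<in>W. cell T n w)"
    using assms(1) unfolding cells_cover_def by blast
  have "cell T n w \<subseteq> cell T n' w" for w
    using assms(2) by (auto simp: cell_def)
  then have "A \<subseteq> (\<Union>w\<in>W. cell T n' w)" using W(4) by blast
  moreover have "\<forall>w\<in>W. \<forall>k<n'. w k \<in> \<U>" using W(3) assms(2) by auto
  ultimately show ?thesis
    unfolding cells_cover_def using W(1,2) assms(3) by (meson order_trans)
qed

lemma cells_cover_Un:
  assumes "cells_cover T \<U> n m A" "cells_cover T \<U> n m' B"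
  shows "cells_cover T \<U> n (m + m') (A \<union> B)"
proof -
  obtain W where W: "finite W" "card W \<le> m" "\<forall>w\<in>W. \<forall>k<n. w k \<in> \<U>" "A \<subseteq> (\<Union>w\<in>W. cell T n w)"
    using assms(1) unfolding cells_cover_def by blast
  obtain W' where W': "finite W'" "card W' \<le> m'" "\<forall>w\<in>W'. \<forall>k<n. w k \<in> \<U>" "B \<subseteq> (\<Union>w\<in>W'. cell T n w)"
    using assms(2) unfolding cells_cover_def by blast
  have "card (W \<union> W') \<le> m + m'" using card_Un_le[of W W'] W(2) W'(2) by linarith
  then show ?thesis
    unfolding cells_cover_def using W W' by (intro exI[of _ "W \<union> W'"]) auto
qed

text \<open>
  The flow is indexed by \<open>int\<close> because the shadowing argument in \<open>cells_cover_hits\<close> runs backwards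
  in time from the visit to a given set.
\<close>

locale cover_flow =
  fixes T :: "int \<Rightarrow> 'p::topological_space \<Rightarrow> 'p" and K :: "'p set" and \<U> :: "'p set set"
  assumes T_zero: "T 0 p = p"
    and T_add: "T (i + j) p = T i (T j p)"
    and continuous_T: "continuous_on UNIV (T i)"
    and Hausdorff: "Hausdorff_space (euclidean :: 'p topology)"
    and compact_K: "compact K"
    and T_K: "p \<in> K \<Longrightarrow> T i p \<in> K"
    and open_\<U>: "U \<in> \<U> \<Longrightarrow> open U"
begin

lemma open_T_vimage: "open U \<Longrightarrow> open (T i -` U)"
  using continuous_T by (intro open_vimage)

lemma open_cell:
  assumes "\<And>k. k < n \<Longrightarrow> w k \<in> \<U>"
  shows "open (cell T n w)"
proof -
  have "cell T n w = (\<Inter>k<n. T (int k) -` w k)" by (auto simp: cell_def)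
  also have "open \<dots>" using assms by (intro open_INT ballI open_T_vimage open_\<U>) auto
  finally show ?thesis .
qed

text \<open>
  Submultiplicativity of the number of itineraries: a point that is back in \<open>U\<close> at every multiple of
  \<open>n\<close> follows a concatenation of \<open>q\<close> of the words that cover \<open>U\<close>.
\<close>

lemma cells_cover_power:
  assumes "cells_cover T \<U> n m U"
  shows "cells_cover T \<U> (q * n) (m ^ q) {p. \<forall>i<q. T (int (i * n)) p \<in> U}"
proof (induction q)
  case 0
  show ?case
    unfolding cells_cover_def by (rule exI[of _ "{undefined}"]) (simp add: cell_def)
next
  case (Suc q)
  obtain W where W: "finite W" "card W \<le> m" "\<forall>w\<in>W. \<forall>k<n. w k \<in> \<U>" "U \<subseteq> (\<Union>w\<in>W. cell T n w)"
    using assms unfolding cells_cover_def by blast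
  obtain Q where Q: "finite Q" "card Q \<le> m ^ q" "\<forall>w\<in>Q. \<forall>k<q * n. w k \<in> \<U>"
    "{p. \<forall>i<q. T (int (i * n)) p \<in> U} \<subseteq> (\<Union>w\<in>Q. cell T (q * n) w)"
    using Suc unfolding cells_cover_def by blast
  define join where "join = (\<lambda>(w :: nat \<Rightarrow> 'p set, w') k. if k < n then w k else w' (k - n))"
  show ?case
    unfolding cells_cover_def
  proof (intro exI[of _ "join ` (W \<times> Q)"] conjI)
    show "finite (join ` (W \<times> Q))" using W(1) Q(1) by simp
    have "card (join ` (W \<times> Q)) \<le> card W * card Q"
      using W(1) Q(1) card_image_le[of "W \<times> Q" join] by (simp add: card_cartesian_product)
    also have "\<dots> \<le> m * m ^ q" using W(2) Q(2) by (rule mult_le_mono)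
    finally show "card (join ` (W \<times> Q)) \<le> m ^ Suc q" by simp
    show "\<forall>w\<in>join ` (W \<times> Q). \<forall>k<Suc q * n. w k \<in> \<U>"
      using W(3) Q(3) by (auto simp: join_def)
    show "{p. \<forall>i<Suc q. T (int (i * n)) p \<in> U} \<subseteq> (\<Union>w\<in>join ` (W \<times> Q). cell T (Suc q * n) w)"
    proof
      fix p assume "p \<in> {p. \<forall>i<Suc q. T (int (i * n)) p \<in> U}"
      then have p: "T (int (i * n)) p \<in> U" if "i < Suc q" for i using that by blast
      have "p \<in> U" using p[of 0] by (simp add: T_zero)
      then obtain w where w: "w \<in> W" "p \<in> cell T n w" using W(4) by blast
      have "T (int (i * n)) (T (int n) p) \<in> U" if "i < q" for i
        using p[of "Suc i"] that by (simp add: T_add[symmetric] algebra_simps)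
      then obtain w' where w': "w' \<in> Q" "T (int n) p \<in> cell T (q * n) w'" using Q(4) by blast
      have "T (int k) p \<in> join (w, w') k" if "k < Suc q * n" for k
      proof (cases "k < n")
        case True
        then show ?thesis using w(2) by (simp add: cell_def join_def)
      next
        case False
        then have "T (int (k - n)) (T (int n) p) \<in> w' (k - n)"
          using w'(2) that by (simp add: cell_def del: of_nat_diff)
        then show ?thesis using False by (simp add: T_add[symmetric] join_def of_nat_diff)
      qed
      then show "p \<in> (\<Union>w\<in>join ` (W \<times> Q). cell T (Suc q * n) w)"
        using w(1) w'(1) by (auto simp: cell_def intro!: bexI[of _ "(w, w')"])
    qed
  qed
qed

text \<open>
  If the set \<open>D\<close> stays inside a single member \<open>N i\<close> of \<open>\<U>\<close> at each time \<open>i\<close>, then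
  visiting \<open>D\<close> at time \<open>s\<close> determines the entire itinerary, namely \<open>N (k - s)\<close> at time \<open>k\<close>. Hence
  the words can be counted by the possible times of visit, independently of \<open>n\<close>.
\<close>

lemma cells_cover_hits:
  assumes N: "\<And>i. N i \<in> \<U>" and I: "finite I"
    and hit: "\<And>p. p \<in> A \<Longrightarrow> \<exists>s\<in>I. T s p \<in> D" and D: "\<And>i p. p \<in> D \<Longrightarrow> T i p \<in> N i"
  shows "cells_cover T \<U> n (card I) A"
  unfolding cells_cover_def
proof (intro exI[of _ "(\<lambda>s k. N (int k - s)) ` I"] conjI)
  show "A \<subseteq> (\<Union>w\<in>(\<lambda>s k. N (int k - s)) ` I. cell T n w)"
  proof
    fix p assume "p \<in> A"
    then obtain s where s: "s \<in> I" "T s p \<in> D" using hit by blast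
    have "T (int k) p \<in> N (int k - s)" for k
      using D[OF s(2), of "int k - s"] by (simp add: T_add[symmetric])
    then show "p \<in> (\<Union>w\<in>(\<lambda>s k. N (int k - s)) ` I. cell T n w)"
      using s(1) by (auto simp: cell_def)
  qed
qed (use N I card_image_le[OF I] in auto)

text \<open>
  Stated for the complement \<open>G\<close> of the minimal closed invariant set of growth at least \<open>r\<^sup>n\<close>. Zorn's
  lemma applies because growth below \<open>r\<^sup>n\<close> at one \<open>n\<close> is witnessed by finitely many open cells: by
  compactness, if the cells cover the complement of the union of a chain, they already cover
  the complement of one of its members.
\<close>

lemma maximal_thick_complement:
  fixes r :: real
  assumes thick: "\<forall>n>0. \<forall>m. cells_cover T \<U> n m K \<longrightarrow> r ^ n \<le> real m"
  shows "\<exists>G. open G \<and> (\<forall>i p. T i p \<in> G \<longrightarrow> p \<in> G) \<and>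
    (\<forall>n>0. \<forall>m. cells_cover T \<U> n m (K - G) \<longrightarrow> r ^ n \<le> real m) \<and>
    (\<forall>H. open H \<and> (\<forall>i p. T i p \<in> H \<longrightarrow> p \<in> H) \<and> G \<subset> H \<longrightarrow>
        (\<exists>n>0. \<exists>m. cells_cover T \<U> n m (K - H) \<and> real m < r ^ n))"
proof -
  define \<A> where "\<A> = {G. open G \<and> (\<forall>i p. T i p \<in> G \<longrightarrow> p \<in> G) \<and>
    (\<forall>n m. n > 0 \<longrightarrow> cells_cover T \<U> n m (K - G) \<longrightarrow> r ^ n \<le> real m)}"
  have "{} \<in> \<A>" using thick by (auto simp: \<A>_def)
  moreover have "\<Union>\<C> \<in> \<A>"  if ne: "\<C> \<noteq> {}" and chain: "subset.chain \<A> \<C>" for \<C>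
  proof -
    have sub: "\<C> \<subseteq> \<A>" using chain by (simp add: subset_chain_def)
    have "r ^ n \<le> real m" if n: "n > 0" and cov: "cells_cover T \<U> n m (K - \<Union>\<C>)" for n m
    proof -
      obtain W where W: "finite W" "card W \<le> m" "\<forall>w\<in>W. \<forall>k<n. w k \<in> \<U>"
        "K - \<Union>\<C> \<subseteq> (\<Union>w\<in>W. cell T n w)"
        using cov unfolding cells_cover_def by blast
      let ?U = "\<Union>w\<in>W. cell T n w"
      have "open ?U" using W(3) by (intro open_UN ballI open_cell) auto
      then have "compact (K - ?U)" using compact_K by (rule compact_diff[rotated])
      moreover have "K - ?U \<subseteq> \<Union>\<C>" "\<And>G. G \<in> \<C> \<Longrightarrow> open G"
        using W(4) sub by (auto simp: \<A>_def)
      ultimately obtain \<D> where \<D>: "\<D> \<subseteq> \<C>" "finite \<D>" "K - ?U \<subseteq> \<Union>\<D>"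
        by (rule compactE)
      obtain G\<^sub>0 where "G\<^sub>0 \<in> \<C>" using ne by blast
      define G where "G = \<Union>(insert G\<^sub>0 \<D>)"
      have fin: "insert G\<^sub>0 \<D> \<subseteq> \<C>" using \<D>(1) \<open>G\<^sub>0 \<in> \<C>\<close> by simp
      have "subset.chain \<A> (insert G\<^sub>0 \<D>)"
        using chain sub fin unfolding subset_chain_def by (meson subsetD subset_trans)
      then have "G \<in> insert G\<^sub>0 \<D>"
        unfolding G_def using \<D>(2) by (intro Union_in_chain) auto
      then have G: "G \<in> \<C>" by (rule subsetD[OF fin])
      have "K - G \<subseteq> ?U" using \<D>(3) by (auto simp: G_def)
      then have "cells_cover T \<U> n m (K - G)" unfolding cells_cover_def using W by blast
      then show ?thesis using G sub n by (auto simp: \<A>_def)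
    qed
    moreover have "open (\<Union>\<C>)" using sub by (intro open_Union) (auto simp: \<A>_def)
    moreover have "p \<in> \<Union>\<C>" if "T i p \<in> \<Union>\<C>" for i p
      using that sub unfolding \<A>_def by blast
    ultimately show ?thesis by (simp add: \<A>_def)
  qed
  ultimately obtain G where G: "G \<in> \<A>" "\<And>H. H \<in> \<A> \<Longrightarrow> G \<subseteq> H \<Longrightarrow> H = G"
    using subset_Zorn_nonempty[of \<A>] by blast
  have "\<exists>n>0. \<exists>m. cells_cover T \<U> n m (K - H) \<and> real m < r ^ n"
    if "open H" "\<forall>i p. T i p \<in> H \<longrightarrow> p \<in> H" "G \<subset> H" for H
  proof -
    have "H \<notin> \<A>" using G(2)[of H] that(3) by blast
    then show ?thesis using that(1,2) unfolding \<A>_def by (auto simp: not_le)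
  qed
  moreover have "open G \<and> (\<forall>i p. T i p \<in> G \<longrightarrow> p \<in> G) \<and>
      (\<forall>n>0. \<forall>m. cells_cover T \<U> n m (K - G) \<longrightarrow> r ^ n \<le> real m)"
    using G(1) by (simp add: \<A>_def)
  ultimately show ?thesis by (intro exI[of _ G]) simp
qed

lemma power_add_linear_less:
  fixes r a :: real
  assumes "1 < r" "0 \<le> a" "a < r ^ k" "0 < k"
  obtains q :: nat where "0 < q" "a ^ q + c * real q < r ^ (q * k)"
proof -
  have R: "r ^ k > 1" using assms by (simp add: one_less_power)
  have "(\<lambda>q. (a / r ^ k) ^ q + c * (real q * (1 / r ^ k) ^ q)) \<longlonglongrightarrow> 0 + c * 0"
    using assms R
    by (intro tendsto_add tendsto_mult LIMSEQ_realpow_zero tendsto_const powser_times_n_limit_0) auto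
  then have "\<forall>\<^sub>F q in sequentially. (a / r ^ k) ^ q + c * (real q * (1 / r ^ k) ^ q) < 1"
    by (intro order_tendstoD(2)) auto
  then obtain N where "\<And>q. q \<ge> N \<Longrightarrow> (a / r ^ k) ^ q + c * (real q * (1 / r ^ k) ^ q) < 1"
    by (auto simp: eventually_sequentially)
  then have *: "(a / r ^ k) ^ Suc N + c * (real (Suc N) * (1 / r ^ k) ^ Suc N) < 1" by (meson le_SucI order_refl)
  have "(a ^ Suc N + c * real (Suc N)) / (r ^ k) ^ Suc N < 1"
    using * by (simp only: power_divide power_one add_divide_distrib times_divide_eq_right mult_1_right mult.assoc)
  moreover have "(r ^ k) ^ Suc N > 0" using assms(1) by simp
  ultimately have "a ^ Suc N + c * real (Suc N) < (r ^ k) ^ Suc N"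
    by (simp only: divide_less_eq_1_pos)
  then show ?thesis using that[of "Suc N"] by (simp only: power_mult[symmetric] mult.commute[of k]) 
qed

text \<open>
  The hypothesis on \<open>D j\<close> makes an orbit visiting it predictable at all times; Baire's theorem
  turns the countable cover into an open set of such orbits inside the minimal set of fast growth.
\<close>

lemma subexponential_cells_cover:
  fixes r :: real
  assumes r: "r > 1"
    and closed_D: "\<And>j. closed (D j)" and D_cover: "K \<subseteq> (\<Union>j :: nat. D j)"
    and D: "\<And>j i. \<exists>U\<in>\<U>. \<forall>p\<in>D j. T i p \<in> U"
  shows "\<exists>n m. n > 0 \<and> cells_cover T \<U> n m K \<and> real m < r ^ n"
proof (rule ccontr)
  assume "\<not> ?thesis"
  then have "\<forall>n>0. \<forall>m. cells_cover T \<U> n m K \<longrightarrow> r ^ n \<le> real m"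
    by (meson not_le)
  from maximal_thick_complement[OF this]
  obtain G where G: "open G" "\<And>i p. T i p \<in> G \<Longrightarrow> p \<in> G"
    and thick: "\<And>n m. n > 0 \<Longrightarrow> cells_cover T \<U> n m (K - G) \<Longrightarrow> r ^ n \<le> real m"
    and max: "\<And>H. open H \<and> (\<forall>i p. T i p \<in> H \<longrightarrow> p \<in> H) \<and> G \<subset> H \<Longrightarrow>
        \<exists>n>0. \<exists>m. cells_cover T \<U> n m (K - H) \<and> real m < r ^ n"
    by (elim exE conjE) simp
  define A where "A = K - G"
  have A_inv: "T i p \<in> A" if "p \<in> A" for i p
    using that G(2) T_K by (auto simp: A_def)
  have compact_A: "compact A" unfolding A_def using compact_K G(1) by (rule compact_diff)
  have "A \<noteq> {}"
  proof
    assume "A = {}"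
    then have "cells_cover T \<U> 1 0 (K - G)"
      unfolding cells_cover_def A_def[symmetric] by (intro exI[of _ "{}"]) simp
    then show False using thick[of 1 0] r by simp
  qed
  moreover have "A \<subseteq> (\<Union>j. D j)" using D_cover by (auto simp: A_def)
  ultimately obtain j W where W: "open W" "A \<inter> W \<noteq> {}" "A \<inter> W \<subseteq> D j"
    using Baire_closed_cover[of A D, OF Hausdorff compact_A _ closed_D] by metis
  \<comment> \<open>Enlarging \<open>G\<close> by the points whose orbit meets \<open>W\<close> leaves the set \<open>A'\<close> of the introduction.\<close>
  define V where "V i = T i -` W" for i
  have open_V: "open (V i)" for i unfolding V_def using W(1) by (rule open_T_vimage)
  let ?H = "G \<union> (\<Union>i. V i)"
  have "G \<subset> ?H"
  proof -
    obtain p where "p \<in> A" "p \<in> W" using W(2) by blast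
    then have "p \<notin> G" "p \<in> V 0" by (auto simp: A_def V_def T_zero)
    then show ?thesis by blast
  qed
  moreover have "p \<in> ?H" if "T i p \<in> ?H" for i p
    using that G(2) by (auto simp: V_def T_add[symmetric])
  moreover have "open ?H" using G(1) open_V by blast
  ultimately obtain k m where k: "k > 0" "cells_cover T \<U> k m (K - ?H)" and m: "real m < r ^ k"
    using max[of ?H] by blast
  obtain Q where Q: "finite Q" "card Q \<le> m" "\<forall>w\<in>Q. \<forall>l<k. w l \<in> \<U>"
    "K - ?H \<subseteq> (\<Union>w\<in>Q. cell T k w)"
    using k(2) unfolding cells_cover_def by blast
  define U where "U = (\<Union>w\<in>Q. cell T k w)"
  have "cells_cover T \<U> k m U" unfolding cells_cover_def U_def using Q(1-3) by blast
  note power = cells_cover_power[OF this]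
  have "open U" unfolding U_def using Q(3) by (intro open_UN ballI open_cell) auto
  then have "compact (A - U)" using compact_A by (rule compact_diff[rotated])
  moreover have "A - U \<subseteq> (\<Union>i\<in>UNIV. V i)" using Q(4) by (auto simp: A_def U_def)
  ultimately obtain I where I: "finite I" "A - U \<subseteq> (\<Union>i\<in>I. V i)"
    using compactE_image[of "A - U" UNIV V] open_V by metis
  obtain q where q: "0 < q" "real m ^ q + real (k * card I) * real q < r ^ (q * k)"
    using power_add_linear_less[of r "real m" k] r m k(1) by (metis of_nat_0_le_iff)
  \<comment> \<open>A point of \<open>A\<close> outside \<open>U\<close> at time \<open>l\<close> meets \<open>W\<close> at time \<open>l + i\<close> for one of the finitely many \<open>i\<close>.\<close>
  define J where "J = (\<lambda>(l, i). int l + i) ` ({..<q * k} \<times> I)"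
  have J: "finite J" "card J \<le> q * k * card I"
    using I(1) card_image_le[of "{..<q * k} \<times> I" "\<lambda>(l, i). int l + i"]
    by (auto simp: J_def card_cartesian_product)
  define B where "B = {p \<in> A. \<exists>l<q * k. T (int l) p \<notin> U}"
  have "\<exists>s\<in>J. T s p \<in> A \<inter> W" if "p \<in> B" for p
  proof -
    from that obtain l where l: "l < q * k" "T (int l) p \<in> A - U" "p \<in> A"
      using A_inv by (auto simp: B_def)
    then obtain i where i: "i \<in> I" "T i (T (int l) p) \<in> W" using I(2) by (auto simp: V_def)
    then have "T (int l + i) p \<in> A \<inter> W"
      using A_inv l(3) by (simp add: T_add[symmetric] add.commute)
    then show ?thesis using l(1) i(1) by (auto simp: J_def)
  qed
  moreover obtain N where N: "\<And>i. N i \<in> \<U>" "\<And>i p. p \<in> D j \<Longrightarrow> T i p \<in> N i"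
    using D[of j] by metis
  ultimately have "cells_cover T \<U> (q * k) (card J) B"
    using W(3) J(1) by (intro cells_cover_hits[of N J B "A \<inter> W"]) auto
  then have "cells_cover T \<U> (q * k) (m ^ q + card J) ({p. \<forall>i<q. T (int (i * k)) p \<in> U} \<union> B)"
    using power by (rule cells_cover_Un[rotated])
  moreover have "K - G \<subseteq> {p. \<forall>i<q. T (int (i * k)) p \<in> U} \<union> B"
  proof
    fix p assume "p \<in> K - G"
    then show "p \<in> {p. \<forall>i<q. T (int (i * k)) p \<in> U} \<union> B"
      using k(1) by (cases "p \<in> B") (auto simp: A_def[symmetric] B_def simp del: of_nat_mult)
  qed
  ultimately have "cells_cover T \<U> (q * k) (m ^ q + card J) (K - G)"
    by (rule cells_cover_subset)
  then have "r ^ (q * k) \<le> real (m ^ q + card J)" using q(1) k(1) by (intro thick) auto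
  also have "\<dots> \<le> real m ^ q + real (q * k * card I)"
    using J(2) by (simp del: of_nat_mult)
  also have "\<dots> = real m ^ q + real (k * card I) * real q" by simp
  finally show False using q(2) by linarith
qed

text \<open>
  One good length \<open>n\<^sub>0\<close> controls all large \<open>n\<close> by submultiplicativity. Rounding \<open>n\<close> up to a multiple of
  \<open>n\<^sub>0\<close> costs at most a factor \<open>\<rho>\<^bsup>n\<^sub>0\<^esup> \<le> \<rho>\<^sup>n\<close>, which is absorbed by working with \<open>\<rho> = \<surd>r\<close>.
\<close>

lemma eventually_cells_cover:
  fixes r :: real
  assumes r: "r > 1"
    and closed_D: "\<And>j. closed (D j)" and D_cover: "K \<subseteq> (\<Union>j :: nat. D j)"
    and D: "\<And>j i. \<exists>U\<in>\<U>. \<forall>p\<in>D j. T i p \<in> U"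
  shows "\<forall>\<^sub>F n in sequentially. \<exists>m. cells_cover T \<U> n m K \<and> real m \<le> r ^ n"
proof -
  define \<rho> where "\<rho> = sqrt r"
  have \<rho>: "1 < \<rho>" "\<rho> ^ 2 = r" using r by (auto simp: \<rho>_def)
  obtain n\<^sub>0 m where n\<^sub>0: "n\<^sub>0 > 0" "cells_cover T \<U> n\<^sub>0 m K" "real m < \<rho> ^ n\<^sub>0"
    using subexponential_cells_cover[OF \<rho>(1) closed_D D_cover D] by blast
  have "\<exists>m. cells_cover T \<U> n m K \<and> real m \<le> r ^ n" if n: "n \<ge> n\<^sub>0" for n
  proof (intro exI conjI)
    define q where "q = n div n\<^sub>0 + 1"
    have q: "n \<le> q * n\<^sub>0" "q * n\<^sub>0 \<le> n + n\<^sub>0"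
      using n\<^sub>0(1) dividend_less_div_times[of n\<^sub>0 n] div_times_less_eq_dividend[of n n\<^sub>0] by (auto simp: q_def)
    have "K \<subseteq> {p. \<forall>i<q. T (int (i * n\<^sub>0)) p \<in> K}" using T_K by blast
    then have "cells_cover T \<U> (q * n\<^sub>0) (m ^ q) K"
      using cells_cover_power[OF n\<^sub>0(2)] by (rule cells_cover_subset[rotated])
    then show "cells_cover T \<U> n (m ^ q) K" using q(1) by (rule cells_cover_mono) simp
    have "real (m ^ q) \<le> (\<rho> ^ n\<^sub>0) ^ q" using n\<^sub>0(3) by (simp add: power_mono)
    also have "\<dots> = \<rho> ^ (q * n\<^sub>0)" by (simp add: power_mult[symmetric] mult.commute)
    also have "\<dots> \<le> \<rho> ^ (2 * n)" using q(2) n \<rho>(1) by (intro power_increasing) auto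
    also have "\<dots> = r ^ n" by (simp add: power_mult \<rho>(2))
    finally show "real (m ^ q) \<le> r ^ n" .
  qed
  then show ?thesis by (auto simp: eventually_sequentially)
qed

end

section \<open>The dual unit ball as a compact flow\<close>

text \<open>
  The unit ball of the dual consists here of plain functions, so that the weak* topology is the
  product topology already carried by \<open>'a \<Rightarrow> complex\<close>.
\<close>

definition dual_fun_ball :: "('a::complex_normed_vector \<Rightarrow> complex) set"
  where "dual_fun_ball = {f. clinear f \<and> (\<forall>x. cmod (f x) \<le> norm x)}"

text \<open>
  Banach--Alaoglu: the ball is cut out of a Tychonoff product of discs by closed conditions.
\<close>

lemma compact_dual_fun_ball: "compact (dual_fun_ball :: ('a::complex_normed_vector \<Rightarrow> complex) set)"
proof -
  let ?B = "\<Pi>\<^sub>E x\<in>UNIV. cball 0 (norm x) :: ('a \<Rightarrow> complex) set"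
  have "compactin (product_topology (\<lambda>_ :: 'a. euclidean :: complex topology) UNIV) ?B"
    unfolding compactin_PiE by auto
  then have "compact ?B" by (simp add: euclidean_product_topology)
  moreover have "closed {f :: 'a \<Rightarrow> complex. clinear f}"
    unfolding clinear_def scaleC_complex_def
    by (intro closed_Collect_conj closed_Collect_all closed_Collect_eq continuous_intros
        continuous_on_product_coordinates)
  moreover have "dual_fun_ball = ?B \<inter> {f :: 'a \<Rightarrow> complex. clinear f}"
    by (auto simp: dual_fun_ball_def PiE_def Pi_def)
  ultimately show ?thesis by (metis compact_Int_closed)
qed

text \<open>
  The centres come from a countable dense subset of the whole dual, so they may lie outside the
  unit ball.
\<close>

lemma countable_norm_net:
  assumes sep: "separable_space (top_of_set (complex_dual :: ('a::complex_normed_vector \<Rightarrow>\<^sub>L complex) set))"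
    and \<epsilon>: "\<epsilon> > 0"
  obtains g :: "nat \<Rightarrow> 'a::complex_normed_vector \<Rightarrow> complex"
  where "\<And>f. f \<in> dual_fun_ball \<Longrightarrow> \<exists>j. \<forall>x. cmod (f x - g j x) \<le> \<epsilon> * norm x"
proof -
  let ?X = "complex_dual :: ('a \<Rightarrow>\<^sub>L complex) set"
  obtain C where C: "countable C" "C \<subseteq> ?X" "top_of_set ?X closure_of C = ?X"
    using sep by (auto simp: separable_space_def)
  have near: "\<exists>G\<in>C. dist F G < \<epsilon>" if "F \<in> ?X" for F
  proof -
    have "F \<in> top_of_set ?X closure_of C" using C(3) that by simp
    then show ?thesis
      unfolding in_closure_of using that \<epsilon>
      by (auto dest!: spec[of _ "?X \<inter> ball F \<epsilon>"])
  qed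
  have "0 \<in> ?X" by (simp add: complex_dual_def clinear_def scaleC_complex_def)
  then have ne: "C \<noteq> {}" using near by blast
  show ?thesis
  proof (rule that[of "\<lambda>j. blinfun_apply (from_nat_into C j)"])
    fix f :: "'a \<Rightarrow> complex" assume f: "f \<in> dual_fun_ball"
    have "bounded_linear f"
      using f clinear_imp_linear[of f]
      by (intro bounded_linear.intro bounded_linear_axioms.intro)
        (auto simp: dual_fun_ball_def intro!: exI[of _ 1])
    then have F: "blinfun_apply (Blinfun f) = f" by (rule bounded_linear_Blinfun_apply)
    then have "Blinfun f \<in> ?X" using f by (simp add: complex_dual_def dual_fun_ball_def)
    then obtain G where G: "G \<in> C" "dist (Blinfun f) G < \<epsilon>" using near by blast
    obtain j where j: "from_nat_into C j = G"
      using from_nat_into_surj[OF C(1) G(1)] by blast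
    have "cmod (f x - blinfun_apply G x) \<le> \<epsilon> * norm x" for x
    proof -
      have "cmod (f x - blinfun_apply G x) = cmod (blinfun_apply (Blinfun f - G) x)"
        by (simp add: F blinfun.diff_left)
      also have "\<dots> \<le> norm (Blinfun f - G) * norm x" by (rule norm_blinfun)
      also have "\<dots> \<le> \<epsilon> * norm x" using G(2) by (intro mult_right_mono) (auto simp: dist_norm)
      finally show ?thesis .
    qed
    then show "\<exists>j. \<forall>x. cmod (f x - blinfun_apply (from_nat_into C j) x) \<le> \<epsilon> * norm x"
      using j by blast
  qed
qed

definition int_funpow :: "('a \<Rightarrow> 'a) \<Rightarrow> int \<Rightarrow> 'a \<Rightarrow> 'a"
  where "int_funpow f i = (if i \<ge> 0 then f ^^ nat i else inv f ^^ nat (- i))"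

lemma int_funpow_of_nat: "int_funpow f (int n) = f ^^ n"
  by (simp add: int_funpow_def)

lemma int_funpow_add_one:
  assumes "bij f"
  shows "int_funpow f (i + 1) = f \<circ> int_funpow f i"
proof (cases "i \<ge> 0")
  case True
  then show ?thesis by (simp add: int_funpow_def nat_add_distrib)
next
  case False
  then have "nat (- i) = Suc (nat (- (i + 1)))" by simp
  then have "f \<circ> int_funpow f i = (f \<circ> inv f) \<circ> inv f ^^ nat (- (i + 1))"
    using False by (simp add: int_funpow_def o_assoc)
  also have "f \<circ> inv f = id" using bij_is_surj[OF assms] by (simp add: surj_iff)
  finally have "f \<circ> int_funpow f i = inv f ^^ nat (- (i + 1))" by (simp only: id_o)
  moreover have "int_funpow f (i + 1) = inv f ^^ nat (- (i + 1))"
    using False by (cases "i = -1") (auto simp: int_funpow_def)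
  ultimately show ?thesis by simp
qed

lemma int_funpow_add:
  assumes "bij f"
  shows "int_funpow f (i + j) = int_funpow f i \<circ> int_funpow f j"
proof (induction i rule: int_induct[where k = 0])
  case base
  show ?case by (simp add: int_funpow_def)
next
  case (step1 i)
  then show ?case
    using int_funpow_add_one[OF assms, of "i + j"] int_funpow_add_one[OF assms, of i]
    by (simp add: algebra_simps o_assoc)
next
  case (step2 i)
  have pred: "f (int_funpow f (k - 1) x) = int_funpow f k x" for k x
    using int_funpow_add_one[OF assms, of "k - 1"] by simp
  have "f (int_funpow f (i - 1 + j) x) = f (int_funpow f (i - 1) (int_funpow f j x))" for x
    using pred[of "i + j" x] pred[of i "int_funpow f j x"] step2 by (simp add: algebra_simps)
  then show ?case using bij_is_inj[OF assms] by (simp add: inj_eq fun_eq_iff)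
qed

lemma isometric_automorphism_bij:
  assumes "isometric_automorphism \<alpha>"
  shows "bij \<alpha>"
proof -
  have lin: "linear \<alpha>" and n: "\<And>x. norm (\<alpha> x) = norm x"
    using assms clinear_imp_linear by (auto simp: isometric_automorphism_def)
  have "inj \<alpha>"
    by (rule injI) (metis n lin linear_diff norm_eq_zero right_minus_eq)
  then show ?thesis using assms by (simp add: bij_def isometric_automorphism_def)
qed

lemma isometric_automorphism_inv:
  assumes "isometric_automorphism \<alpha>"
  shows "isometric_automorphism (inv \<alpha>)"
proof -
  have b: "bij \<alpha>" using assms by (rule isometric_automorphism_bij)
  have inv: "\<alpha> (inv \<alpha> x) = x" "inv \<alpha> (\<alpha> x) = x" for x
    using b by (simp_all add: bij_is_surj surj_f_inv_f bij_is_inj)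
  have \<alpha>: "\<alpha> (x + y) = \<alpha> x + \<alpha> y" "\<alpha> (c *\<^sub>C x) = c *\<^sub>C \<alpha> x" for x y c
    using assms by (simp_all add: isometric_automorphism_def clinear_def)
  have "clinear (inv \<alpha>)"
    unfolding clinear_def
  proof (intro conjI allI)
    show "inv \<alpha> (x + y) = inv \<alpha> x + inv \<alpha> y" for x y
      using inv(2)[of "inv \<alpha> x + inv \<alpha> y"] by (simp add: \<alpha> inv(1))
    show "inv \<alpha> (c *\<^sub>C x) = c *\<^sub>C inv \<alpha> x" for c x
      using inv(2)[of "c *\<^sub>C inv \<alpha> x"] by (simp add: \<alpha> inv(1))
  qed
  moreover have "norm (inv \<alpha> x) = norm x" for x
    using assms by (metis inv(1) isometric_automorphism_def)
  ultimately show ?thesis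
    using b by (simp add: isometric_automorphism_def bij_imp_bij_inv bij_is_surj)
qed

lemma isometric_automorphism_comp:
  assumes "isometric_automorphism \<alpha>" "isometric_automorphism \<beta>"
  shows "isometric_automorphism (\<alpha> \<circ> \<beta>)"
  using assms comp_surj[of \<beta> \<alpha>] by (simp add: isometric_automorphism_def clinear_def)

lemma isometric_automorphism_funpow:
  assumes "isometric_automorphism \<alpha>"
  shows "isometric_automorphism (\<alpha> ^^ n)"
proof (induction n)
  case 0
  show ?case by (simp add: isometric_automorphism_def clinear_def)
next
  case (Suc n)
  then show ?case unfolding funpow.simps by (rule isometric_automorphism_comp[OF assms])
qed

lemma isometric_automorphism_int_funpow:
  "isometric_automorphism \<alpha> \<Longrightarrow> isometric_automorphism (int_funpow \<alpha> i)"
  by (simp add: int_funpow_def isometric_automorphism_funpow isometric_automorphism_inv)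

definition small_open_sets :: "'a set \<Rightarrow> real \<Rightarrow> ('a \<Rightarrow> complex) set set"
  where "small_open_sets \<Omega> \<delta> = {U. open U \<and> (\<forall>f\<in>U. \<forall>g\<in>U. \<forall>x\<in>\<Omega>. cmod (f x - g x) < \<delta>)}"

lemma cover_flow_dual:
  assumes \<alpha>: "isometric_automorphism \<alpha>"
  shows "cover_flow (\<lambda>i f. f \<circ> int_funpow \<alpha> i) dual_fun_ball (small_open_sets \<Omega> \<delta>)"
proof
  show "Hausdorff_space (euclidean :: ('a \<Rightarrow> complex) topology)" by (rule Hausdorff_space_fun)
  fix i j and f :: "'a \<Rightarrow> complex"
  show "f \<circ> int_funpow \<alpha> 0 = f" by (simp add: int_funpow_def)
  show "f \<circ> int_funpow \<alpha> (i + j) = f \<circ> int_funpow \<alpha> j \<circ> int_funpow \<alpha> i"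
    using int_funpow_add[OF isometric_automorphism_bij[OF \<alpha>], of j i] by (simp add: o_assoc add.commute)
  show "continuous_on UNIV (\<lambda>f :: 'a \<Rightarrow> complex. f \<circ> int_funpow \<alpha> i)"
    by (intro continuous_on_coordinatewise_then_product) simp
  show "f \<circ> int_funpow \<alpha> i \<in> dual_fun_ball" if "f \<in> dual_fun_ball"
    using that isometric_automorphism_int_funpow[OF \<alpha>, of i]
    unfolding dual_fun_ball_def isometric_automorphism_def clinear_def by auto metis
qed (auto simp: compact_dual_fun_ball small_open_sets_def)

text \<open>
  Closed norm balls of a fixed small radius \<open>\<epsilon>\<close> play the role of the sets \<open>D j\<close>. Composition with
  powers of \<open>\<alpha>\<close> preserves the norm distance to the centre, so at every time the translated
  ball lies within \<open>\<delta> / 2\<close> of one function on \<open>\<Omega>\<close>.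
\<close>

lemma eventually_dual_cells_cover:
  fixes \<alpha> :: "'a::complex_normed_vector \<Rightarrow> 'a"
  assumes \<alpha>: "isometric_automorphism \<alpha>"
    and sep: "separable_space (top_of_set (complex_dual :: ('a \<Rightarrow>\<^sub>L complex) set))"
    and "finite \<Omega>" "\<delta> > 0" "r > 1"
  shows "\<forall>\<^sub>F n in sequentially. \<exists>m. real m \<le> r ^ n \<and>
    cells_cover (\<lambda>i f. f \<circ> int_funpow \<alpha> i) (small_open_sets \<Omega> \<delta>) n m dual_fun_ball"
proof -
  interpret cover_flow "\<lambda>i f. f \<circ> int_funpow \<alpha> i" dual_fun_ball "small_open_sets \<Omega> \<delta>"
    using \<alpha> by (rule cover_flow_dual)
  \<comment> \<open>The radius is chosen so that \<open>\<epsilon> * norm x < \<delta> / 2\<close> on \<open>\<Omega>\<close>; the added 1 covers the case that \<open>\<Omega> \<subseteq> {0}\<close>.\<close>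
  define \<epsilon> where "\<epsilon> = \<delta> / (4 * (1 + sum norm \<Omega>))"
  have M: "sum norm \<Omega> \<ge> 0" by (simp add: sum_nonneg)
  then have \<epsilon>: "\<epsilon> > 0" using assms(4) by (simp add: \<epsilon>_def)
  have \<epsilon>\<Omega>: "\<epsilon> * norm x < \<delta> / 2" if "x \<in> \<Omega>" for x
  proof -
    have "\<epsilon> * norm x \<le> \<epsilon> * (1 + sum norm \<Omega>)"
      using member_le_sum[of x \<Omega> norm] that assms(3) \<epsilon> by (intro mult_left_mono) auto
    also have "\<dots> = \<delta> / 4" using M by (simp add: \<epsilon>_def field_simps)
    finally show ?thesis using assms(4) by simp
  qed
  obtain g :: "nat \<Rightarrow> 'a \<Rightarrow> complex"
    where g: "\<And>f. f \<in> dual_fun_ball \<Longrightarrow> \<exists>j. \<forall>x. cmod (f x - g j x) \<le> \<epsilon> * norm x"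
    using countable_norm_net[OF sep \<epsilon>] by blast
  define D where "D j = {f. \<forall>x. cmod (f x - g j x) \<le> \<epsilon> * norm x}" for j
  have "closed (D j)" for j
    unfolding D_def
    by (intro closed_Collect_all closed_Collect_le continuous_intros continuous_on_product_coordinates)
  moreover have "dual_fun_ball \<subseteq> (\<Union>j. D j)" using g by (auto simp: D_def)
  moreover have "\<exists>U\<in>small_open_sets \<Omega> \<delta>. \<forall>f\<in>D j. f \<circ> int_funpow \<alpha> i \<in> U" for i j
  proof
    define U where "U = {f. \<forall>x\<in>\<Omega>. cmod (f x - g j (int_funpow \<alpha> i x)) < \<delta> / 2}"
    have "U = (\<Inter>x\<in>\<Omega>. {f. cmod (f x - g j (int_funpow \<alpha> i x)) < \<delta> / 2})" by (auto simp: U_def)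
    also have "open \<dots>"
      using assms(3) by (intro open_INT ballI open_Collect_less continuous_intros
          continuous_on_product_coordinates)
    finally have "open U" .
    moreover have "cmod (f x - h x) < \<delta>" if "f \<in> U" "h \<in> U" "x \<in> \<Omega>" for f h x
      using that norm_triangle_ineq4[of "f x - g j (int_funpow \<alpha> i x)" "h x - g j (int_funpow \<alpha> i x)"]
      by (fastforce simp: U_def)
    ultimately show "U \<in> small_open_sets \<Omega> \<delta>" by (simp add: small_open_sets_def)
    show "\<forall>f\<in>D j. f \<circ> int_funpow \<alpha> i \<in> U"
    proof
      fix f assume "f \<in> D j"
      have "cmod (f (int_funpow \<alpha> i x) - g j (int_funpow \<alpha> i x)) < \<delta> / 2" if "x \<in> \<Omega>" for x
      proof -
        have "cmod (f (int_funpow \<alpha> i x) - g j (int_funpow \<alpha> i x)) \<le> \<epsilon> * norm (int_funpow \<alpha> i x)"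
          using \<open>f \<in> D j\<close> by (simp add: D_def)
        also have "norm (int_funpow \<alpha> i x) = norm x"
          using isometric_automorphism_int_funpow[OF \<alpha>] by (simp add: isometric_automorphism_def)
        also have "\<epsilon> * norm x < \<delta> / 2" using that by (rule \<epsilon>\<Omega>)
        finally show ?thesis .
      qed
      then show "f \<circ> int_funpow \<alpha> i \<in> U" by (simp add: U_def)
    qed
  qed
  ultimately show ?thesis
    using eventually_cells_cover[OF assms(5), of D] by (simp add: conj_commute)
qed

section \<open>Bounding the CA rank by covering numbers\<close>

text \<open>
  A net of the dual ball also serves the coordinate functionals of an arbitrary approximate
  factorization, however large its dimension is: the map from the new
  \<open>\<ell>\<^sub>\<infinity>\<close> first repeats coordinates and then applies the old map into the codomain of \<open>\<iota>\<close>.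
\<close>

lemma rc_le_card_net:
  fixes \<iota> :: "'a::complex_banach \<Rightarrow> 'b::complex_banach"
  assumes \<iota>: "CA_embedding \<iota>" and \<Omega>: "finite \<Omega>" and \<delta>: "\<delta> > 0"
    and G: "finite G" "G \<subseteq> dual_fun_ball"
    and net: "\<And>f. f \<in> dual_fun_ball \<Longrightarrow> \<exists>g\<in>G. \<forall>x\<in>\<Omega>. cmod (f x - g x) < \<delta>"
  shows "rc \<iota> \<Omega> (2 * \<delta>) \<le> card G"
proof -
  obtain \<phi>\<^sub>1 \<psi>\<^sub>1 d\<^sub>1 where "(\<phi>\<^sub>1, \<psi>\<^sub>1, d\<^sub>1) \<in> CA \<iota> \<Omega> \<delta>"
    using \<iota> \<Omega> \<delta> unfolding CA_embedding_def by (metis all_not_in_conv prod_cases3)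
  then have d\<^sub>1: "d\<^sub>1 > 0" and \<phi>\<^sub>1: "contractive_to_linf d\<^sub>1 \<phi>\<^sub>1" and \<psi>\<^sub>1: "contractive_from_linf d\<^sub>1 \<psi>\<^sub>1"
    and approx: "\<And>x. x \<in> \<Omega> \<Longrightarrow> norm (\<psi>\<^sub>1 (\<phi>\<^sub>1 x) - \<iota> x) < \<delta>"
    by (auto simp: CA_def)
  have coord: "(\<lambda>x. \<phi>\<^sub>1 x j) \<in> dual_fun_ball" if "j < d\<^sub>1" for j
  proof -
    have "cmod (\<phi>\<^sub>1 x j) \<le> norm x" for x
      using linf_norm_bound[OF d\<^sub>1 that, of "\<phi>\<^sub>1 x"] \<phi>\<^sub>1 by (meson contractive_to_linf_def order_trans)
    then show ?thesis
      using \<phi>\<^sub>1 by (simp add: dual_fun_ball_def clinear_def contractive_to_linf_def scaleC_complex_def)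
  qed
  have "G \<noteq> {}" using net[OF coord[OF d\<^sub>1]] by blast
  define d where "d = card G"
  have d: "d > 0" using G(1) \<open>G \<noteq> {}\<close> by (simp add: d_def card_gt_0_iff)
  obtain e where "bij_betw e {0..<d} G"
    using ex_bij_betw_nat_finite[OF G(1)] unfolding d_def by blast
  then have e: "e ` {..<d} = G" by (simp add: bij_betw_def atLeast0LessThan)
  have eb: "e i \<in> dual_fun_ball" if "i < d" for i using that e G(2) by blast
  have "\<exists>i<d. \<forall>x\<in>\<Omega>. cmod (\<phi>\<^sub>1 x j - e i x) < \<delta>" if "j < d\<^sub>1" for j
    using net[OF coord[OF that]] unfolding e[symmetric] by auto
  then obtain \<sigma> where \<sigma>: "\<And>j. j < d\<^sub>1 \<Longrightarrow> \<sigma> j < d"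
    "\<And>j x. j < d\<^sub>1 \<Longrightarrow> x \<in> \<Omega> \<Longrightarrow> cmod (\<phi>\<^sub>1 x j - e (\<sigma> j) x) < \<delta>"
    by metis
  define \<phi> where "\<phi> x i = (if i < d then e i x else 0)" for x i
  \<comment> \<open>\<open>pull\<close> repeats the coordinates of \<open>\<ell>\<^sub>\<infinity>\<^bsup>d\<^esup>\<close> along \<open>\<sigma>\<close>; it is a contraction into \<open>\<ell>\<^sub>\<infinity>\<^bsup>d\<^sub>1\<^esup>\<close>.\<close>
  define pull where "pull v j = (if j < d\<^sub>1 then v (\<sigma> j) else 0)" for v :: "nat \<Rightarrow> complex" and j
  have pull_linf: "pull v \<in> linf d\<^sub>1" for v by (simp add: pull_def linf_def)
  have "contractive_to_linf d \<phi>"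
    unfolding contractive_to_linf_def
  proof (intro conjI allI)
    fix x
    show "linf_norm d (\<phi> x) \<le> norm x"
      using d eb unfolding linf_norm_def by (subst Max_le_iff) (auto simp: \<phi>_def dual_fun_ball_def)
  qed (use eb in \<open>auto simp: \<phi>_def linf_def fun_eq_iff dual_fun_ball_def clinear_def scaleC_complex_def\<close>)
  moreover have "contractive_from_linf d (\<lambda>v. \<psi>\<^sub>1 (pull v))"
    unfolding contractive_from_linf_def
  proof (intro conjI ballI allI)
    fix u v :: "nat \<Rightarrow> complex" and c
    have "pull (\<lambda>i. u i + v i) = (\<lambda>j. pull u j + pull v j)" by (auto simp: pull_def)
    then show "\<psi>\<^sub>1 (pull (\<lambda>i. u i + v i)) = \<psi>\<^sub>1 (pull u) + \<psi>\<^sub>1 (pull v)"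
      using \<psi>\<^sub>1 pull_linf by (simp add: contractive_from_linf_def)
    have "pull (\<lambda>i. c * v i) = (\<lambda>j. c * pull v j)" by (auto simp: pull_def)
    then show "\<psi>\<^sub>1 (pull (\<lambda>i. c * v i)) = c *\<^sub>C \<psi>\<^sub>1 (pull v)"
      using \<psi>\<^sub>1 pull_linf by (simp add: contractive_from_linf_def)
    have "norm (\<psi>\<^sub>1 (pull v)) \<le> linf_norm d\<^sub>1 (pull v)"
      using \<psi>\<^sub>1 pull_linf by (simp add: contractive_from_linf_def)
    also have "\<dots> \<le> linf_norm d v"
      unfolding linf_norm_def[of d\<^sub>1] using d\<^sub>1
      by (subst Max_le_iff) (auto simp: pull_def intro!: linf_norm_bound[OF d] \<sigma>(1))
    finally show "norm (\<psi>\<^sub>1 (pull v)) \<le> linf_norm d v" .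
  qed
  moreover have "norm (\<psi>\<^sub>1 (pull (\<phi> x)) - \<iota> x) < 2 * \<delta>" if "x \<in> \<Omega>" for x
  proof -
    define w where "w j = pull (\<phi> x) j - \<phi>\<^sub>1 x j" for j
    have \<phi>\<^sub>1x: "\<phi>\<^sub>1 x \<in> linf d\<^sub>1" using \<phi>\<^sub>1 by (simp add: contractive_to_linf_def)
    then have w: "w \<in> linf d\<^sub>1" using pull_linf by (simp add: w_def linf_def)
    have "pull (\<phi> x) = (\<lambda>j. \<phi>\<^sub>1 x j + w j)" by (simp add: w_def)
    then have "\<psi>\<^sub>1 (pull (\<phi> x)) = \<psi>\<^sub>1 (\<phi>\<^sub>1 x) + \<psi>\<^sub>1 w"
      using \<psi>\<^sub>1 \<phi>\<^sub>1x w by (simp add: contractive_from_linf_def)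
    moreover have "norm (\<psi>\<^sub>1 w) \<le> linf_norm d\<^sub>1 w" using \<psi>\<^sub>1 w by (simp add: contractive_from_linf_def)
    moreover have "linf_norm d\<^sub>1 w < \<delta>"
      unfolding linf_norm_def using d\<^sub>1 \<sigma> that
      by (subst Max_less_iff) (auto simp: w_def pull_def \<phi>_def norm_minus_commute)
    ultimately show ?thesis
      using approx[OF that] norm_triangle_ineq[of "\<psi>\<^sub>1 (\<phi>\<^sub>1 x) - \<iota> x" "\<psi>\<^sub>1 w"]
      by (simp add: algebra_simps)
  qed
  ultimately have "(\<phi>, \<lambda>v. \<psi>\<^sub>1 (pull v), d) \<in> CA \<iota> \<Omega> (2 * \<delta>)" using d by (simp add: CA_def)
  then show ?thesis unfolding rc_def d_def[symmetric] by (intro cInf_lower) auto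
qed

text \<open>
  Two functionals in the same cell differ by less than \<open>\<delta>\<close> on every \<open>\<alpha>\<^bsup>k\<^esup>\<Omega>\<close> with \<open>k < n\<close>, so one
  functional per cell gives the net.
\<close>

lemma rc_le_dual_cells:
  fixes \<iota> :: "'a::complex_banach \<Rightarrow> 'b::complex_banach"
  assumes \<iota>: "CA_embedding \<iota>" and \<Omega>: "finite \<Omega>" and \<delta>: "\<delta> > 0"
    and cover: "cells_cover (\<lambda>i f. f \<circ> int_funpow \<alpha> i) (small_open_sets \<Omega> \<delta>) n m dual_fun_ball"
  shows "rc \<iota> (\<Union>k<n. (\<alpha> ^^ k) ` \<Omega>) (2 * \<delta>) \<le> m"
proof -
  let ?cell = "cell (\<lambda>i f. f \<circ> int_funpow \<alpha> i) n"
  obtain W where W: "finite W" "card W \<le> m" "\<forall>w\<in>W. \<forall>k<n. w k \<in> small_open_sets \<Omega> \<delta>"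
    "dual_fun_ball \<subseteq> (\<Union>w\<in>W. ?cell w)"
    using cover unfolding cells_cover_def by blast
  \<comment> \<open>Cells that miss the dual ball offer no functional to choose, so they are discarded.\<close>
  define W' where "W' = {w \<in> W. dual_fun_ball \<inter> ?cell w \<noteq> {}}"
  have W': "finite W'" "card W' \<le> m"
    using W(1,2) card_mono[of W W'] by (auto simp: W'_def)
  define c where "c w = (SOME f. f \<in> dual_fun_ball \<inter> ?cell w)" for w
  have c: "c w \<in> dual_fun_ball \<inter> ?cell w" if "w \<in> W'" for w
    unfolding c_def using that by (intro some_in_eq[THEN iffD2]) (simp add: W'_def)
  have "rc \<iota> (\<Union>k<n. (\<alpha> ^^ k) ` \<Omega>) (2 * \<delta>) \<le> card (c ` W')"
  proof (rule rc_le_card_net[OF \<iota> _ \<delta>])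
    fix f :: "'a \<Rightarrow> complex" assume f: "f \<in> dual_fun_ball"
    then obtain w where w: "w \<in> W" "f \<in> ?cell w" using W(4) by blast
    then have w': "w \<in> W'" using f by (auto simp: W'_def)
    have "cmod (f ((\<alpha> ^^ k) x) - c w ((\<alpha> ^^ k) x)) < \<delta>" if "k < n" "x \<in> \<Omega>" for k x
    proof -
      have "f \<circ> \<alpha> ^^ k \<in> w k" "c w \<circ> \<alpha> ^^ k \<in> w k"
        using w(2) c[OF w'] that(1) by (auto simp: cell_def int_funpow_of_nat)
      moreover have "w k \<in> small_open_sets \<Omega> \<delta>" using W(3) w(1) that(1) by blast
      ultimately show ?thesis using that(2) by (fastforce simp: small_open_sets_def)
    qed
    then show "\<exists>g\<in>c ` W'. \<forall>x\<in>\<Union>k<n. (\<alpha> ^^ k) ` \<Omega>. cmod (f x - g x) < \<delta>"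
      using w' by auto
  qed (use \<Omega> W'(1) c in auto)
  also have "\<dots> \<le> m" using card_image_le[OF W'(1), of c] W'(2) by linarith
  finally show ?thesis .
qed

section \<open>Vanishing of the CA entropy\<close>

lemma rc_pos:
  assumes "CA_embedding \<iota>" "finite \<Omega>" "\<delta> > 0"
  shows "rc \<iota> \<Omega> \<delta> > 0"
proof -
  have "CA \<iota> \<Omega> \<delta> \<noteq> {}" using assms by (simp add: CA_embedding_def)
  then have "{d. \<exists>\<phi> \<psi>. (\<phi>, \<psi>, d) \<in> CA \<iota> \<Omega> \<delta>} \<noteq> {}" by auto
  then have "rc \<iota> \<Omega> \<delta> \<in> {d. \<exists>\<phi> \<psi>. (\<phi>, \<psi>, d) \<in> CA \<iota> \<Omega> \<delta>}"
    unfolding rc_def by (rule Inf_nat_def1)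
  then show ?thesis by (auto simp: CA_def)
qed

lemma hc_at_eq_0:
  fixes \<iota> :: "'a::complex_banach \<Rightarrow> 'b::complex_banach" and \<alpha> :: "'a \<Rightarrow> 'a"
  assumes \<iota>: "CA_embedding \<iota>"
    and sep: "separable_space (top_of_set (complex_dual :: ('a \<Rightarrow>\<^sub>L complex) set))"
    and \<alpha>: "isometric_automorphism \<alpha>"
    and \<Omega>: "finite \<Omega>" and \<delta>: "\<delta> > 0"
  shows "hc_at \<iota> \<alpha> \<Omega> \<delta> = 0"
proof (rule antisym)
  let ?R = "\<lambda>n. rc \<iota> (\<Union>k<n. (\<alpha> ^^ k) ` \<Omega>) \<delta>"
  have pos: "?R n > 0" for n using \<iota> \<Omega> \<delta> by (intro rc_pos) auto
  show "0 \<le> hc_at \<iota> \<alpha> \<Omega> \<delta>"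
    unfolding hc_at_def using pos
    by (intro le_Limsup) (auto intro!: always_eventually mult_nonneg_nonneg simp: Suc_le_eq)
  have "hc_at \<iota> \<alpha> \<Omega> \<delta> \<le> ereal \<eta>" if \<eta>: "\<eta> > 0" for \<eta>
  proof -
    have "\<forall>\<^sub>F n in sequentially. \<exists>m. real m \<le> exp \<eta> ^ n \<and>
      cells_cover (\<lambda>i f. f \<circ> int_funpow \<alpha> i) (small_open_sets \<Omega> (\<delta> / 2)) n m dual_fun_ball"
      using \<alpha> sep \<Omega> \<delta> \<eta> by (intro eventually_dual_cells_cover) auto
    then have "\<forall>\<^sub>F n in sequentially. ereal (1 / real n * ln (real (?R n))) \<le> ereal \<eta>"
      using eventually_gt_at_top[of 0]
    proof eventually_elim
      case (elim n)
      then obtain m where m: "real m \<le> exp \<eta> ^ n"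
        "cells_cover (\<lambda>i f. f \<circ> int_funpow \<alpha> i) (small_open_sets \<Omega> (\<delta> / 2)) n m dual_fun_ball"
        by blast
      have "?R n \<le> m" using rc_le_dual_cells[OF \<iota> \<Omega> _ m(2)] \<delta> by simp
      then have "real (?R n) \<le> exp (real n * \<eta>)"
        using m(1) by (simp add: exp_of_nat_mult)
      then have "ln (real (?R n)) \<le> real n * \<eta>"
        using pos[of n] ln_mono[of "real (?R n)" "exp (real n * \<eta>)"] by simp
      then show ?case using elim(2) by (simp add: field_simps)
    qed
    then show ?thesis unfolding hc_at_def by (rule Limsup_bounded)
  qed
  then show "hc_at \<iota> \<alpha> \<Omega> \<delta> \<le> 0"
    using ereal_le_epsilon2[of "hc_at \<iota> \<alpha> \<Omega> \<delta>" 0] by simp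
qed

theorem corollary3p9:
  fixes \<iota> :: "'a::complex_banach \<Rightarrow> 'b::complex_banach"
    and \<alpha> :: "'a \<Rightarrow> 'a"
  assumes "CA_embedding \<iota>"
    and "separable_space (top_of_set (complex_dual :: ('a \<Rightarrow>\<^sub>L complex) set))"
    and "isometric_automorphism \<alpha>"
  shows "hc \<iota> \<alpha> = 0"
proof -
  have "hc_set \<iota> \<alpha> \<Omega> = 0" if "finite \<Omega>" for \<Omega>
  proof -
    have "hc_set \<iota> \<alpha> \<Omega> = (SUP \<delta>\<in>{0::real<..}. 0)"
      unfolding hc_set_def using hc_at_eq_0[OF assms that] by (intro SUP_cong) auto
    then show ?thesis by simp
  qed
  then have "hc \<iota> \<alpha> = (SUP \<Omega>\<in>{\<Omega> :: 'a set. finite \<Omega>}. 0)"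
    unfolding hc_def by (intro SUP_cong) auto
  also have "\<dots> = 0" by (intro cSUP_const) auto
  finally show ?thesis .
qed

end
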